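(* Let $N\ge 1$ and let $f\in C^1([0,\infty))\cap C^2((0,\infty))$ satisfy $f(0)=0$, and $f(u)>0$, $f'(u)>0$, $f''(u)>0$ for all $u>0$, and $$F(u):=\int_u^\infty \frac{ds}{f(s)}<\infty\quad\text{for all } u>0 .$$ Assume that the limit $q:=\lim_{s\to+0}f'(s)F(s)$ exists. If $q=1$, assume furthermore that there exists a constant $s_0>0$ such that $f'(s)F(s)\ge1$ for $0<s<s_0$. Then there exists a constant $\Gamma_*$ such that, for every nonnegative initial function $u_0\in L^\infty(\mathbb{R}^N)$ satisfying $$\liminf_{|x|\to\infty}\frac{|x|^2}{F(u_0(x))}\ge\Gamma_*,$$ there exists no global in time solution of $$\partial_t u=\Delta u+f(u)\ \text{ in } \mathbb{R}^N\times(0,\infty),\qquad u(\cdot,0)=u_0\ \text{ in } \mathbb{R}^N .$$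
   Context: Under the hypotheses on $f$, $F:(0,\infty)\to(0,\infty)$ is a strictly decreasing bijection with $F(u)\to\infty$ as $u\to+0$; convention: $F(0)=\infty$, so that $|x|^2/F(u_0(x))=0$ where $u_0(x)=0$. Existence of the limit $q$ means existence as a real number. The constant $\Gamma_*$ is a positive real number, depending only on $N$ and $f$. For $u_0\in L^\infty(\mathbb{R}^N)$ the $\liminf$ as $|x|\to\infty$ is understood in the almost everywhere sense. A global in time solution with $u_0\in L^\infty(\mathbb{R}^N)$, $u_0\ge0$, is a nonnegative function $u\in C^{2,1}(\mathbb{R}^N\times(0,\infty))$, bounded on $\mathbb{R}^N\times(0,T)$ for every $T<\infty$, satisfying the equation pointwise for $t>0$ and $\|u(\cdot,t)-e^{t\Delta}u_0\|_{L^\infty(\mathbb{R}^N)}\to0$ as $t\to+0$, where $(e^{t\Delta}u_0)(x)=(4\pi t)^{-N/2}\int_{\mathbb{R}^N}e^{-|x-y|^2/(4t)}u_0(y)\,dy$. *)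

theory Defs
  imports "HOL-Probability.Essential_Supremum"
begin

text \<open>
  The space \<open>\<real>\<^sup>N\<close> is an arbitrary type of class \<open>euclidean_space\<close>, with \<open>N = DIM('a)\<close> and the
  coordinate directions given by \<open>Basis\<close>.
\<close>

definition F_tail :: "(real \<Rightarrow> real) \<Rightarrow> real \<Rightarrow> ennreal" where
  "F_tail f u = (if u = 0 then \<infinity> else (\<integral>\<^sup>+ s\<in>{u..}. ennreal (1 / f s) \<partial>lborel))"

definition Linf_norm :: "('a::euclidean_space \<Rightarrow> real) \<Rightarrow> ennreal" where
  "Linf_norm g = esssup lebesgue (\<lambda>x. ennreal \<bar>g x\<bar>)"

definition Linf :: "('a::euclidean_space \<Rightarrow> real) set" where
  "Linf = {g. g \<in> borel_measurable lebesgue \<and> Linf_norm g < \<infinity>}"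

text \<open>
  A property holds eventually along the following filter iff it holds for almost every \<open>x\<close> with
  \<open>norm x \<ge> R\<close>, for some \<open>R\<close>. Hence \<open>Liminf\<close> along it is the supremum over \<open>R\<close> of the essential
  infimum over \<open>norm x \<ge> R\<close>.
\<close>

definition ae_at_infinity :: "'a::euclidean_space filter" where
  "ae_at_infinity = inf at_infinity (ae_filter lebesgue)"

definition partial_deriv :: "'a::euclidean_space \<Rightarrow> ('a \<Rightarrow> real) \<Rightarrow> 'a \<Rightarrow> real" where
  "partial_deriv i g x = deriv (\<lambda>h. g (x + h *\<^sub>R i)) 0"

definition has_partial :: "'a::euclidean_space \<Rightarrow> ('a \<Rightarrow> real) \<Rightarrow> bool" where
  "has_partial i g \<longleftrightarrow> (\<forall>x. (\<lambda>h. g (x + h *\<^sub>R i)) field_differentiable (at 0))"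

definition laplacian :: "('a::euclidean_space \<Rightarrow> real) \<Rightarrow> 'a \<Rightarrow> real" where
  "laplacian g x = (\<Sum>i\<in>Basis. partial_deriv i (partial_deriv i g) x)"

text \<open>
  The class \<open>C\<^sup>2\<^sup>,\<^sup>1\<close> on \<open>\<real>\<^sup>N \<times> (0,\<infinity>)\<close>: two derivatives in space and one in time, all jointly
  continuous. Values of \<open>u\<close> at nonpositive times play no role.
\<close>

definition C21 :: "('a::euclidean_space \<Rightarrow> real \<Rightarrow> real) \<Rightarrow> bool" where
  "C21 u \<longleftrightarrow>
     continuous_on (UNIV \<times> {0<..}) (\<lambda>(x, t). u x t) \<and>
     (\<forall>x. \<forall>t>0. u x field_differentiable (at t)) \<and>
     continuous_on (UNIV \<times> {0<..}) (\<lambda>(x, t). deriv (u x) t) \<and>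
     (\<forall>i\<in>Basis.
        (\<forall>t>0. has_partial i (\<lambda>x. u x t)) \<and>
        continuous_on (UNIV \<times> {0<..}) (\<lambda>(x, t). partial_deriv i (\<lambda>y. u y t) x)) \<and>
     (\<forall>i\<in>Basis. \<forall>j\<in>Basis.
        (\<forall>t>0. has_partial j (partial_deriv i (\<lambda>x. u x t))) \<and>
        continuous_on (UNIV \<times> {0<..})
          (\<lambda>(x, t). partial_deriv j (partial_deriv i (\<lambda>y. u y t)) x))"

text \<open>
  The integral is over \<open>lebesgue\<close> rather than \<open>lborel\<close>, because elements of \<open>Linf\<close> need only be
  Lebesgue measurable.
\<close>

definition heat_semigroup :: "real \<Rightarrow> ('a::euclidean_space \<Rightarrow> real) \<Rightarrow> 'a \<Rightarrow> real" where
  "heat_semigroup t g x =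
     (4 * pi * t) powr (- real DIM('a) / 2) *
     (\<integral>y. exp (- (norm (x - y))\<^sup>2 / (4 * t)) * g y \<partial>lebesgue)"

definition global_solution ::
    "(real \<Rightarrow> real) \<Rightarrow> ('a::euclidean_space \<Rightarrow> real) \<Rightarrow> ('a \<Rightarrow> real \<Rightarrow> real) \<Rightarrow> bool" where
  "global_solution f u0 u \<longleftrightarrow>
     C21 u \<and>
     (\<forall>x. \<forall>t>0. 0 \<le> u x t) \<and>
     (\<forall>T>0. bounded ((\<lambda>(x, t). u x t) ` (UNIV \<times> {0<..<T}))) \<and>
     (\<forall>x. \<forall>t>0. deriv (u x) t = laplacian (\<lambda>y. u y t) x + f (u x t)) \<and>
     ((\<lambda>t. Linf_norm (\<lambda>x. u x t - heat_semigroup t u0 x)) \<longlongrightarrow> 0) (at_right 0)"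

end

theory Submission
  imports Defs "HOL-Probability.Distributions" "HOL-Real_Asymp.Real_Asymp"
begin

text \<open>
  Let \<open>\<Psi>\<close> be the inverse of \<open>F\<close>. If \<open>V\<close> is affine in \<open>\<bar>x\<bar>\<^sup>2\<close> and \<open>t\<close>, then
  \<open>U = \<Psi> \<circ> V\<close> satisfies \<open>U\<^sub>t - \<Delta> U - f U = f U (\<Delta> V - V\<^sub>t - 1) - f' U f U \<bar>\<nabla>V\<bar>\<^sup>2\<close>. Hence
  \<open>\<Psi> (b + (\<bar>x\<bar>\<^sup>2 + 2Nt) / G - t)\<close> is a subsolution, and for \<open>G > 2N\<close> it blows up at \<open>x = 0\<close> in finite
  time. A solution that lies above it at some time cannot be global.

  The datum only dominates \<open>\<Psi> (\<bar>x\<bar>\<^sup>2 / G)\<close> outside a ball of radius \<open>R\<close>. To gain positivity inside, one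
  compares with the subsolution of the heat equation \<open>\<Psi> (a + (\<bar>x\<bar>\<^sup>2 + 2Nt) / G) - M g(x,t)\<close>, where the
  Gaussian \<open>g\<close> solves the heat equation and \<open>M\<close> makes the difference nonpositive in the ball at \<open>t = 0\<close>. The
  Gaussian decreases with time and has light tails, whereas \<open>\<Psi>\<close> and \<open>f \<circ> \<Psi>\<close> decay subexponentially
  because \<open>f' (0+) = 0\<close>, as \<open>f' F\<close> stays bounded and \<open>F\<close> does not. So at some
  time the difference lies above \<open>\<Psi> (b + \<bar>x\<bar>\<^sup>2 / G)\<close> for a large \<open>b\<close>.
\<close>

section \<open>Comparison principles\<close>

lemma norm_add_scaleR_Basis_power2:
  fixes y :: "'a::euclidean_space"
  assumes "i \<in> Basis"
  shows "(norm (y + h *\<^sub>R i))\<^sup>2 = (norm y)\<^sup>2 + 2 * h * (y \<bullet> i) + h\<^sup>2"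
  using assms unfolding power2_norm_eq_inner
  by (simp add: inner_add_left inner_add_right inner_commute algebra_simps power2_eq_square inner_same_Basis)

text \<open>If \<open>c\<close> were positive, \<open>\<phi>'\<close>, which vanishes at the
  maximum, would be positive just to the right of \<open>0\<close>, and the mean value theorem would
  give a larger value of \<open>\<phi>\<close> there.\<close>

lemma second_deriv_nonpos_at_max:
  fixes \<phi> \<phi>' :: "real \<Rightarrow> real"
  assumes d1: "\<And>h. (\<phi> has_real_derivative \<phi>' h) (at h)"
    and d2: "(\<phi>' has_real_derivative c) (at 0)"
    and max: "\<And>h. \<phi> h \<le> \<phi> 0"
  shows "c \<le> 0"
proof (rule ccontr)
  assume "\<not> c \<le> 0"
  have z: "\<phi>' 0 = 0"
    using DERIV_local_max[OF d1, of 1] max by auto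
  obtain d where d: "d > 0" "\<And>h. h > 0 \<Longrightarrow> h < d \<Longrightarrow> \<phi>' 0 < \<phi>' (0 + h)"
    using DERIV_pos_inc_right[OF d2] \<open>\<not> c \<le> 0\<close> by auto
  obtain \<xi> where \<xi>: "0 < \<xi>" "\<xi> < d/2" "\<phi> (d/2) - \<phi> 0 = (d/2 - 0) * \<phi>' \<xi>"
    using MVT2[of 0 "d/2" \<phi> \<phi>'] d(1) d1 by auto
  have "\<phi>' \<xi> > 0" using d(2)[of \<xi>] \<xi> z d(1) by auto
  then have "(d/2 - 0) * \<phi>' \<xi> > 0" using d(1) by simp
  then have "\<phi> (d/2) - \<phi> 0 > 0" using \<xi>(3) by simp
  then show False using max[of "d/2"] by simp
qed

text \<open>Only times before \<open>t\<close> are compared, because a space-time maximum may be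
  attained at the last time of the interval.\<close>

lemma deriv_nonneg_at_left_max:
  fixes \<phi> :: "real \<Rightarrow> real"
  assumes d: "(\<phi> has_real_derivative c) (at t)" and "a < t"
    and max: "\<And>s. a \<le> s \<Longrightarrow> s \<le> t \<Longrightarrow> \<phi> s \<le> \<phi> t"
  shows "c \<ge> 0"
proof (rule ccontr)
  assume "\<not> c \<ge> 0"
  then obtain d where d: "d > 0" "\<And>h. h > 0 \<Longrightarrow> h < d \<Longrightarrow> \<phi> t < \<phi> (t - h)"
    using DERIV_neg_dec_left[OF d] by auto
  define h where "h = min (d/2) (t - a)"
  have "h > 0" "h < d" "t - h \<ge> a" using d \<open>a < t\<close> by (auto simp: h_def min_def)
  then show False using d(2)[of h] max[of "t - h"] by auto
qed

text \<open>
  The barrier \<open>\<epsilon> (1 + \<bar>x\<bar>\<^sup>2 + (2N+1)(t-a))\<close> forces a positive maximum to be attained, and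
  makes the differential inequality strict there.
\<close>

lemma maximum_principle:
  fixes g :: "'a::euclidean_space \<Rightarrow> real \<Rightarrow> real"
  assumes cont: "continuous_on (UNIV \<times> {a..b}) (\<lambda>(x, t). g x t)"
    and bdd: "\<And>x t. t \<in> {a..b} \<Longrightarrow> g x t \<le> B"
    and init: "\<And>x. g x a \<le> 0"
    and L: "L \<ge> 0"
    and diff: "\<And>x t. a < t \<Longrightarrow> t \<le> b \<Longrightarrow> g x t > 0 \<Longrightarrow>
      \<exists>gt G1 G2. (g x has_real_derivative gt) (at t) \<and>
        (\<forall>i\<in>Basis. (\<forall>h. ((\<lambda>h. g (x + h *\<^sub>R i) t) has_real_derivative G1 i h) (at h)) \<and>
           (G1 i has_real_derivative G2 i) (at 0)) \<and>
        gt \<le> (\<Sum>i\<in>Basis. G2 i) + L * g x t"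
    and t: "t \<in> {a..b}"
  shows "g x t \<le> 0"
proof (rule ccontr)
  assume "\<not> g x t \<le> 0"
  define N where "N = real DIM('a)"
  define bar where "bar = (\<lambda>(x::'a) s. 1 + (norm x)\<^sup>2 + (2 * N + 1) * (s - a))"
  have N: "N \<ge> 0" by (simp add: N_def)
  have bar: "bar y s \<ge> 1 + (norm y)\<^sup>2" if "s \<ge> a" for y s
    using that N by (simp add: bar_def)
  \<comment> \<open>This makes \<open>\<epsilon> * bar x t\<close> half of the weighted positive
    value at \<open>(x, t)\<close>, so that \<open>k x t\<close> keeps the other half.\<close>
  define \<epsilon> where "\<epsilon> = exp (- L * (t - a)) * g x t / (2 * bar x t)"
  have bar_pos: "bar x t > 0" using bar[of t x] t by (smt (verit) atLeastAtMost_iff zero_le_power2)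
  have \<epsilon>: "\<epsilon> > 0" using \<open>\<not> g x t \<le> 0\<close> bar_pos by (simp add: \<epsilon>_def)
  \<comment> \<open>The exponential weight absorbs the zeroth-order term
    \<open>L * g\<close>.\<close>
  define k where "k = (\<lambda>y s. exp (- L * (s - a)) * g y s - \<epsilon> * bar y s)"
  have kxt: "k x t > 0"
    using \<open>\<not> g x t \<le> 0\<close> bar_pos by (simp add: k_def \<epsilon>_def field_simps)
  have B: "B > 0" using bdd[OF t, of x] \<open>\<not> g x t \<le> 0\<close> by simp
  \<comment> \<open>Beyond radius \<open>sqrt (B / \<epsilon>)\<close> the barrier exceeds the bound
    \<open>B\<close> on \<open>g\<close>; including \<open>norm x\<close> keeps
    \<open>(x, t)\<close> in the compact set.\<close>
  define r where "r = max (norm x) (sqrt (B / \<epsilon>))"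
  have far: "k y s < 0" if "s \<in> {a..b}" "norm y > r" for y s
  proof -
    have "B / \<epsilon> < (norm y)\<^sup>2"
    proof -
      have "sqrt (B / \<epsilon>) < norm y" using that by (simp add: r_def)
      then show ?thesis by (metis norm_ge_zero real_sqrt_less_iff real_sqrt_abs2 real_sqrt_unique power2_eq_square)
    qed
    then have "B < \<epsilon> * (norm y)\<^sup>2" using \<epsilon> by (simp add: field_simps)
    also have "\<dots> \<le> \<epsilon> * bar y s" using bar[of s y] that \<epsilon> by auto
    finally have "B < \<epsilon> * bar y s" .
    moreover have "exp (- L * (s - a)) * g y s \<le> B"
    proof (cases "g y s \<le> 0")
      case True
      then have "exp (- L * (s - a)) * g y s \<le> 0" by (simp add: mult_nonneg_nonpos)
      then show ?thesis using B by linarith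
    next
      case False
      have "exp (- L * (s - a)) \<le> 1" using that L by simp
      then have "exp (- L * (s - a)) * g y s \<le> 1 * g y s"
        using False by (intro mult_right_mono) auto
      then show ?thesis using bdd[OF that(1), of y] by simp
    qed
    ultimately show ?thesis by (simp add: k_def)
  qed
  define S where "S = cball (0::'a) r \<times> {a..b}"
  have "compact S" unfolding S_def by (intro compact_Times) auto
  moreover have "(x, t) \<in> S" using t by (simp add: S_def r_def)
  moreover have "continuous_on S (\<lambda>p. k (fst p) (snd p))"
  proof -
    have "continuous_on S (\<lambda>p. g (fst p) (snd p))"
      using continuous_on_subset[OF cont, of S] by (auto simp: S_def case_prod_beta)
    then show ?thesis unfolding k_def bar_def by (intro continuous_intros)
  qed
  ultimately obtain p where p: "p \<in> S" "\<And>q. q \<in> S \<Longrightarrow> k (fst q) (snd q) \<le> k (fst p) (snd p)"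
    using continuous_attains_sup[of S "\<lambda>p. k (fst p) (snd p)"] by blast
  obtain y s where ys: "p = (y, s)" by (cases p)
  have s: "s \<in> {a..b}" using p ys by (auto simp: S_def)
  have kpos: "k y s > 0" using p(2)[of "(x,t)"] \<open>(x, t) \<in> S\<close> kxt ys by auto
  have kmax: "k z w \<le> k y s" if "w \<in> {a..b}" for z w
  proof (cases "norm z \<le> r")
    case True
    then show ?thesis using p(2)[of "(z,w)"] that ys by (auto simp: S_def)
  next
    case False
    then show ?thesis using far[OF that, of z] kpos by simp
  qed
  have "bar y s > 0" using bar[of s y] s by (smt (verit) atLeastAtMost_iff zero_le_power2)
  then have "\<epsilon> * bar y s > 0" using \<epsilon> by simp
  then have "exp (- L * (s - a)) * g y s > 0" using kpos by (simp add: k_def)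
  then have gpos: "g y s > 0" by (simp add: zero_less_mult_iff)
  have sa: "a < s" using init[of y] gpos s by (cases "s = a") auto
  obtain gt G1 G2 where G: "(g y has_real_derivative gt) (at s)"
    "\<And>i h. i \<in> Basis \<Longrightarrow> ((\<lambda>h. g (y + h *\<^sub>R i) s) has_real_derivative G1 i h) (at h)"
    "\<And>i. i \<in> Basis \<Longrightarrow> (G1 i has_real_derivative G2 i) (at 0)"
    "gt \<le> (\<Sum>i\<in>Basis. G2 i) + L * g y s"
    using diff[OF sa _ gpos] s by (auto simp: atLeastAtMost_iff) metis
  define E where "E = exp (- L * (s - a))"
  have E: "E > 0" by (simp add: E_def)
  have "(k y has_real_derivative (E * gt - L * E * g y s - \<epsilon> * (2 * N + 1))) (at s)"
    unfolding k_def bar_def E_def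
    by (rule derivative_eq_intros G(1) refl | simp)+ 
  then have kt: "E * gt - L * E * g y s - \<epsilon> * (2 * N + 1) \<ge> 0"
    by (rule deriv_nonneg_at_left_max[OF _ sa]) (use kmax s in auto)
  have "E * G2 i - 2 * \<epsilon> \<le> 0" if i: "i \<in> Basis" for i
  proof (rule second_deriv_nonpos_at_max)
    note nrm = norm_add_scaleR_Basis_power2[OF i, of y]
    show "((\<lambda>h. k (y + h *\<^sub>R i) s) has_real_derivative E * G1 i h - \<epsilon> * (2 * (y \<bullet> i) + 2 * h)) (at h)" for h
      unfolding k_def bar_def E_def nrm
      by (rule derivative_eq_intros G(2)[OF i] refl | simp)+
    show "((\<lambda>h. E * G1 i h - \<epsilon> * (2 * (y \<bullet> i) + 2 * h)) has_real_derivative E * G2 i - 2 * \<epsilon>) (at 0)"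
      by (rule derivative_eq_intros G(3)[OF i] refl | simp)+
    show "k (y + h *\<^sub>R i) s \<le> k (y + 0 *\<^sub>R i) s" for h
      using kmax[OF s] by simp
  qed
  then have "(\<Sum>i\<in>Basis. E * G2 i - 2 * \<epsilon>) \<le> 0" by (intro sum_nonpos) auto
  then have "E * (\<Sum>i\<in>Basis. G2 i) - 2 * \<epsilon> * N \<le> 0"
    by (simp add: sum_subtractf sum_distrib_left N_def mult_ac)
  moreover have "E * gt \<le> E * ((\<Sum>i\<in>Basis. G2 i) + L * g y s)"
    using G(4) E by (intro mult_left_mono) auto
  \<comment> \<open>The time slope of \<open>bar\<close> is \<open>2 * N + 1\<close> and its
    Laplacian is \<open>2 * N\<close>; the derivative tests at the maximum therefore give \<epsilon>
    (2N + 1) \<le> 2N \<epsilon>.\<close>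
  ultimately show False using kt \<epsilon> by (simp add: algebra_simps)
qed

lemma partial_deriv_along_line:
  assumes "has_partial i g"
  shows "((\<lambda>h. g (x + h *\<^sub>R i)) has_real_derivative partial_deriv i g (x + h *\<^sub>R i)) (at h)"
proof -
  have "((\<lambda>k. g ((x + h *\<^sub>R i) + k *\<^sub>R i)) has_real_derivative partial_deriv i g (x + h *\<^sub>R i)) (at 0)"
    using assms unfolding has_partial_def partial_deriv_def
    by (simp add: DERIV_deriv_iff_field_differentiable)
  then have "((\<lambda>k. g (x + (k + h) *\<^sub>R i)) has_real_derivative partial_deriv i g (x + h *\<^sub>R i)) (at 0)"
    by (simp add: scaleR_add_left add_ac)
  then show ?thesis
    using DERIV_shift[of "\<lambda>k. g (x + k *\<^sub>R i)" _ 0 h] by simp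
qed

text \<open>In the variable \<rho> = |x|^2 the Laplacian of a radial function is
  \<open>4 * \<rho> * H2 + 2 * N * H1\<close>, so \<open>maximum_principle\<close> applies to the
  difference of \<open>H\<close> and \<open>u\<close>. The inequality is asked only where
  \<open>u\<close> lies below \<open>H\<close>; there \<open>L\<close> can absorb a difference of
  values of \<open>f\<close>. The starting time is positive since \<open>u\<close> is regular only
  for positive times.\<close>

lemma radial_comparison:
  fixes u :: "'a::euclidean_space \<Rightarrow> real \<Rightarrow> real" and H H1 H2 Ht :: "real \<Rightarrow> real \<Rightarrow> real"
  assumes C21: "C21 u"
    and eq: "\<And>x t. t > 0 \<Longrightarrow> deriv (u x) t = laplacian (\<lambda>y. u y t) x + f (u x t)"
    and nonneg: "\<And>x t. t > 0 \<Longrightarrow> 0 \<le> u x t"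
    and a: "0 < a"
    and d1: "\<And>\<rho> t. 0 \<le> \<rho> \<Longrightarrow> a < t \<Longrightarrow> t \<le> b \<Longrightarrow> ((\<lambda>\<rho>. H \<rho> t) has_real_derivative H1 \<rho> t) (at \<rho>)"
    and d2: "\<And>\<rho> t. 0 \<le> \<rho> \<Longrightarrow> a < t \<Longrightarrow> t \<le> b \<Longrightarrow> ((\<lambda>\<rho>. H1 \<rho> t) has_real_derivative H2 \<rho> t) (at \<rho>)"
    and dt: "\<And>\<rho> t. 0 \<le> \<rho> \<Longrightarrow> a < t \<Longrightarrow> t \<le> b \<Longrightarrow> (H \<rho> has_real_derivative Ht \<rho> t) (at t)"
    and cont: "continuous_on ({0..} \<times> {a..b}) (\<lambda>(\<rho>, t). H \<rho> t)"
    and bdd: "\<And>\<rho> t. 0 \<le> \<rho> \<Longrightarrow> t \<in> {a..b} \<Longrightarrow> H \<rho> t \<le> B"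
    and init: "\<And>x. H ((norm x)\<^sup>2) a \<le> u x a"
    and L: "L \<ge> 0"
    and ineq: "\<And>x t. a < t \<Longrightarrow> t \<le> b \<Longrightarrow> u x t < H ((norm x)\<^sup>2) t \<Longrightarrow>
      Ht ((norm x)\<^sup>2) t \<le> 4 * (norm x)\<^sup>2 * H2 ((norm x)\<^sup>2) t + 2 * real DIM('a) * H1 ((norm x)\<^sup>2) t
        + f (u x t) + L * (H ((norm x)\<^sup>2) t - u x t)"
    and t: "t \<in> {a..b}"
  shows "H ((norm x)\<^sup>2) t \<le> u x t"
proof -
  have "H ((norm x)\<^sup>2) t - u x t \<le> 0"
  proof (rule maximum_principle[where g = "\<lambda>x t. H ((norm x)\<^sup>2) t - u x t" and a = a and b = b and B = B and L = L])
    show "continuous_on (UNIV \<times> {a..b}) (\<lambda>(x, t). H ((norm x)\<^sup>2) t - u x t)"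
    proof -
      have "continuous_on (UNIV \<times> {0<..}) (\<lambda>(x, t). u x t)" using C21 by (simp add: C21_def)
      then have "continuous_on (UNIV \<times> {a..b}) (\<lambda>(x, t). u x t)"
        by (rule continuous_on_subset) (use a in auto)
      moreover have "continuous_on (UNIV \<times> {a..b}) (\<lambda>p::'a\<times>real. (\<lambda>(\<rho>, t). H \<rho> t) ((norm (fst p))\<^sup>2, snd p))"
        by (rule continuous_on_compose2[OF cont]) (auto intro!: continuous_intros)
      ultimately show ?thesis
        unfolding case_prod_beta by (intro continuous_on_diff) auto
    qed
    show "H ((norm x)\<^sup>2) t - u x t \<le> B" if "t \<in> {a..b}" for x t
      using bdd[OF _ that, of "(norm x)\<^sup>2"] nonneg[of t x] that a by auto
    show "H ((norm x)\<^sup>2) a - u x a \<le> 0" for x using init by simp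
    show "L \<ge> 0" by fact
    show "t \<in> {a..b}" by fact
    show "\<exists>gt G1 G2. ((\<lambda>t. H ((norm x)\<^sup>2) t - u x t) has_real_derivative gt) (at t) \<and>
        (\<forall>i\<in>Basis. (\<forall>h. ((\<lambda>h. H ((norm (x + h *\<^sub>R i))\<^sup>2) t - u (x + h *\<^sub>R i) t) has_real_derivative G1 i h) (at h)) \<and>
           (G1 i has_real_derivative G2 i) (at 0)) \<and>
        gt \<le> (\<Sum>i\<in>Basis. G2 i) + L * (H ((norm x)\<^sup>2) t - u x t)"
      if t: "a < t" "t \<le> b" and pos: "H ((norm x)\<^sup>2) t - u x t > 0" for x t
    proof -
      define \<rho> where "\<rho> = (\<lambda>i h. (norm (x + h *\<^sub>R i))\<^sup>2)"
      define U1 where "U1 = (\<lambda>i. partial_deriv i (\<lambda>y. u y t))"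
      define G1 where "G1 = (\<lambda>i h. H1 (\<rho> i h) t * (2 * (x \<bullet> i) + 2 * h) - U1 i (x + h *\<^sub>R i))"
      define G2 where "G2 = (\<lambda>i. H2 ((norm x)\<^sup>2) t * (2 * (x \<bullet> i))\<^sup>2 + 2 * H1 ((norm x)\<^sup>2) t
        - partial_deriv i (U1 i) x)"
      have t0: "t > 0" using a t by simp
      have \<rho>0: "\<rho> i 0 = (norm x)\<^sup>2" for i by (simp add: \<rho>_def)
      have \<rho>_nonneg: "\<rho> i h \<ge> 0" for i h by (simp add: \<rho>_def)
      have d\<rho>: "(\<rho> i has_real_derivative (2 * (x \<bullet> i) + 2 * h)) (at h)" if "i \<in> Basis" for i h
        unfolding \<rho>_def norm_add_scaleR_Basis_power2[OF that]
        by (auto intro!: derivative_eq_intros)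
      have ut: "(u x has_real_derivative deriv (u x) t) (at t)"
        using C21 t0 by (simp add: C21_def DERIV_deriv_iff_field_differentiable)
      have "((\<lambda>t. H ((norm x)\<^sup>2) t - u x t) has_real_derivative (Ht ((norm x)\<^sup>2) t - deriv (u x) t)) (at t)"
        using dt[OF _ t, of "(norm x)\<^sup>2"] ut by (auto intro!: derivative_eq_intros)
      moreover have "((\<lambda>h. H (\<rho> i h) t - u (x + h *\<^sub>R i) t) has_real_derivative G1 i h) (at h)"
        if i: "i \<in> Basis" for i h
      proof -
        have "((\<lambda>h. u (x + h *\<^sub>R i) t) has_real_derivative U1 i (x + h *\<^sub>R i)) (at h)"
          unfolding U1_def
          by (rule partial_deriv_along_line) (use C21 t0 i in \<open>auto simp: C21_def\<close>)
        moreover have "((\<lambda>h. H (\<rho> i h) t) has_real_derivative H1 (\<rho> i h) t * (2 * (x \<bullet> i) + 2 * h)) (at h)"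
          by (rule DERIV_chain2[OF d1[OF \<rho>_nonneg t] d\<rho>[OF i]])
        ultimately show ?thesis unfolding G1_def by (intro DERIV_diff)
      qed
      moreover have "(G1 i has_real_derivative G2 i) (at 0)" if i: "i \<in> Basis" for i
      proof -
        have "((\<lambda>h. U1 i (x + h *\<^sub>R i)) has_real_derivative partial_deriv i (U1 i) (x + 0 *\<^sub>R i)) (at 0)"
          by (rule partial_deriv_along_line) (use C21 t0 i in \<open>auto simp: C21_def U1_def\<close>)
        moreover have "((\<lambda>h. H1 (\<rho> i h) t) has_real_derivative H2 (\<rho> i 0) t * (2 * (x \<bullet> i) + 2 * 0)) (at 0)"
          by (rule DERIV_chain2[OF d2[OF \<rho>_nonneg t] d\<rho>[OF i]])
        ultimately show ?thesis unfolding G1_def G2_def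
          by (auto intro!: derivative_eq_intros simp: \<rho>0 power2_eq_square algebra_simps)
      qed
      moreover have "Ht ((norm x)\<^sup>2) t - deriv (u x) t \<le> (\<Sum>i\<in>Basis. G2 i) + L * (H ((norm x)\<^sup>2) t - u x t)"
      proof -
        have "(\<Sum>i\<in>Basis. (x \<bullet> i)\<^sup>2) = (norm x)\<^sup>2"
          unfolding power2_norm_eq_inner by (subst euclidean_inner) (simp add: power2_eq_square)
        then have "(\<Sum>i\<in>Basis. G2 i) = 4 * (norm x)\<^sup>2 * H2 ((norm x)\<^sup>2) t
            + 2 * real DIM('a) * H1 ((norm x)\<^sup>2) t - laplacian (\<lambda>y. u y t) x"
          unfolding G2_def laplacian_def U1_def
          by (simp add: sum.distrib sum_subtractf power_mult_distrib flip: sum_distrib_left)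
        then show ?thesis using ineq[OF t] pos eq[OF t0, of x] by (smt (verit))
      qed
      ultimately show ?thesis unfolding \<rho>_def by blast
    qed
  qed
  then show ?thesis by simp
qed

section \<open>The heat semigroup for small times\<close>

text \<open>The kernel factors over the coordinates, and each factor is
  \<open>sqrt (4 * pi * t)\<close> times a normal density of variance \<open>2 * t\<close>.\<close>

lemma has_bochner_integral_gaussian:
  fixes x :: "'a::euclidean_space"
  assumes t: "t > 0"
  shows "has_bochner_integral lebesgue (\<lambda>y. exp (- (norm (x - y))\<^sup>2 / (4 * t))) ((4 * pi * t) powr (real DIM('a) / 2))"
proof -
  have nn1: "(\<integral>\<^sup>+ y. ennreal (exp (- (y - m)\<^sup>2 / (4 * t))) \<partial>lborel) = ennreal (sqrt (4 * pi * t))" for m :: real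
  proof -
    define \<sigma> where "\<sigma> = sqrt (2 * t)"
    have \<sigma>: "\<sigma> > 0" "\<sigma>\<^sup>2 = 2 * t" using t by (auto simp: \<sigma>_def)
    have e: "exp (- (y - m)\<^sup>2 / (4 * t)) = sqrt (4 * pi * t) * normal_density m \<sigma> y" for y
      using t by (simp add: normal_density_def \<sigma> field_simps)
    have "(\<integral>\<^sup>+ y. ennreal (normal_density m \<sigma> y) \<partial>lborel) = ennreal (\<integral> y. normal_density m \<sigma> y \<partial>lborel)"
      by (rule nn_integral_eq_integral) (use \<sigma> in auto)
    also have "\<dots> = 1" using \<sigma> by simp
    finally show ?thesis
      unfolding e using t by (simp add: ennreal_mult nn_integral_cmult)
  qed
  have prod: "exp (- (norm (x - y))\<^sup>2 / (4 * t)) = (\<Prod>b\<in>Basis. exp (- (y \<bullet> b - x \<bullet> b)\<^sup>2 / (4 * t)))" for y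
  proof -
    have "(norm (x - y))\<^sup>2 = (\<Sum>b\<in>Basis. (y \<bullet> b - x \<bullet> b)\<^sup>2)"
      unfolding power2_norm_eq_inner
      by (subst euclidean_inner) (simp add: power2_eq_square inner_diff_left algebra_simps)
    then show ?thesis
      by (simp add: sum_divide_distrib sum_negf flip: exp_sum)
  qed
  have "(\<integral>\<^sup>+ y. ennreal (exp (- (norm (x - y))\<^sup>2 / (4 * t))) \<partial>lebesgue)
      = (\<integral>\<^sup>+ y. (\<Prod>b\<in>Basis. ennreal (exp (- (y \<bullet> b - x \<bullet> b)\<^sup>2 / (4 * t)))) \<partial>lborel)"
    unfolding prod nn_integral_completion by (simp add: prod_ennreal)
  also have "\<dots> = (\<Prod>b\<in>(Basis::'a set). \<integral>\<^sup>+ y. ennreal (exp (- (y - x \<bullet> b)\<^sup>2 / (4 * t))) \<partial>lborel)"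
    by (rule nn_integral_lborel_prod) auto
  also have "\<dots> = ennreal (sqrt (4 * pi * t) ^ DIM('a))"
    unfolding nn1 using t by (simp add: ennreal_power)
  also have "sqrt (4 * pi * t) ^ DIM('a) = (4 * pi * t) powr (real DIM('a) / 2)"
    using t by (simp add: powr_half_sqrt[symmetric] powr_realpow[symmetric] powr_powr)
  finally show ?thesis
    by (intro has_bochner_integral_nn_integral) (auto intro!: measurable_completion)
qed

text \<open>Half of the exponent pays for the factor \<open>r\<close>: with a = r / sqrt t one has a
  \<le> 2 exp (a^2 / 8). The remaining half is the kernel at the doubled time \<open>2 * t\<close>,
  whose integral is known.\<close>

lemma norm_mult_gaussian_le:
  fixes r :: real
  assumes "t > 0"
  shows "r * exp (- r\<^sup>2 / (4 * t)) \<le> 2 * sqrt t * exp (- r\<^sup>2 / (8 * t))"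
proof -
  define a where "a = r / sqrt t"
  have r: "r = a * sqrt t" "r\<^sup>2 = a\<^sup>2 * t" using assms by (auto simp: a_def power_divide)
  have "a \<le> 2 * (1 + a\<^sup>2 / 8)"
    using zero_le_power2[of "a - 2"] by (simp add: power2_eq_square algebra_simps)
  also have "\<dots> \<le> 2 * exp (a\<^sup>2 / 8)" by (intro mult_left_mono exp_ge_add_one_self) auto
  finally have "a * exp (- a\<^sup>2 / 4) \<le> 2 * exp (a\<^sup>2 / 8) * exp (- a\<^sup>2 / 4)" by (rule mult_right_mono) simp
  also have "\<dots> = 2 * exp (- a\<^sup>2 / 8)" by (simp add: field_simps flip: exp_add)
  finally have "sqrt t * (a * exp (- a\<^sup>2 / 4)) \<le> sqrt t * (2 * exp (- a\<^sup>2 / 8))"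
    using assms by (intro mult_left_mono) auto
  then show ?thesis using assms unfolding r(2) by (simp add: r(1) mult_ac)
qed

lemma Linf_bounded:
  assumes "u0 \<in> Linf"
  obtains C where "AE x in lebesgue. \<bar>u0 x\<bar> \<le> C"
proof -
  have fin: "Linf_norm u0 < \<infinity>" using assms by (simp add: Linf_def)
  have "AE x in lebesgue. \<bar>u0 x\<bar> \<le> enn2real (Linf_norm u0)"
  proof (rule AE_mp[OF esssup_AE[of "\<lambda>x. ennreal \<bar>u0 x\<bar>" lebesgue]], intro AE_I2 impI)
    fix x assume "ennreal \<bar>u0 x\<bar> \<le> esssup lebesgue (\<lambda>x. ennreal \<bar>u0 x\<bar>)"
    then have "ennreal \<bar>u0 x\<bar> \<le> Linf_norm u0" by (simp add: Linf_norm_def)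
    then have "enn2real (ennreal \<bar>u0 x\<bar>) \<le> enn2real (Linf_norm u0)"
      using fin by (intro enn2real_mono) auto
    then show "\<bar>u0 x\<bar> \<le> enn2real (Linf_norm u0)" by simp
  qed
  then show thesis by (rule that)
qed

text \<open>The datum lies above the cone of slope \<open>K\<close> with apex
  \<open>\<phi> x\<close>. Averaging the cone against the kernel costs \<open>K\<close> times the
  first moment, which \<open>norm_mult_gaussian_le\<close> bounds by 2 sqrt t times the kernel at
  time \<open>2 * t\<close>; the unnormalised mass of that kernel is larger by the factor
  2^(N/2).\<close>

lemma heat_semigroup_ge:
  fixes u0 \<phi> :: "'a::euclidean_space \<Rightarrow> real"
  assumes u0: "u0 \<in> Linf" and le: "AE y in lebesgue. \<phi> y \<le> u0 y"
    and lip: "\<And>y. \<phi> x - K * norm (x - y) \<le> \<phi> y" and K: "K \<ge> 0" and t: "t > 0"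
  shows "\<phi> x - 2 * K * sqrt t * 2 powr (real DIM('a) / 2) \<le> heat_semigroup t u0 x"
proof -
  define G where "G = (\<lambda>t (y::'a). exp (- (norm (x - y))\<^sup>2 / (4 * t)))"
  define m where "m = (\<lambda>t. (4 * pi * t) powr (real DIM('a) / 2))"
  have G: "has_bochner_integral lebesgue (G s) (m s)" if "s > 0" for s
    unfolding G_def m_def by (rule has_bochner_integral_gaussian[OF that])
  obtain C where C: "AE y in lebesgue. \<bar>u0 y\<bar> \<le> C" using Linf_bounded[OF u0] .
  have int: "integrable lebesgue (\<lambda>y. G t y * u0 y)"
  proof (rule Bochner_Integration.integrable_bound)
    show "integrable lebesgue (\<lambda>y. C * G t y)"
      using G[OF t] by (auto simp: has_bochner_integral_iff)
    have "G t \<in> borel_measurable lebesgue"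
      using G[OF t] by (auto simp: has_bochner_integral_iff)
    then show "(\<lambda>y. G t y * u0 y) \<in> borel_measurable lebesgue"
      using u0 by (auto simp: Linf_def)
    show "AE y in lebesgue. norm (G t y * u0 y) \<le> norm (C * G t y)"
      using C by eventually_elim (auto simp: G_def abs_mult mult.commute intro!: mult_right_mono)
  qed
  have low: "has_bochner_integral lebesgue (\<lambda>y. \<phi> x * G t y - 2 * K * sqrt t * G (2 * t) y)
      (\<phi> x * m t - 2 * K * sqrt t * m (2 * t))"
    using t by (intro has_bochner_integral_diff has_bochner_integral_mult_right G) auto
  have "\<phi> x * m t - 2 * K * sqrt t * m (2 * t) \<le> (\<integral>y. G t y * u0 y \<partial>lebesgue)"
    unfolding has_bochner_integral_integral_eq[OF low, symmetric]
  proof (rule integral_mono_AE)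
    show "integrable lebesgue (\<lambda>y. \<phi> x * G t y - 2 * K * sqrt t * G (2 * t) y)"
      using low by (simp add: has_bochner_integral_iff)
    show "AE y in lebesgue. \<phi> x * G t y - 2 * K * sqrt t * G (2 * t) y \<le> G t y * u0 y"
      using le
    proof eventually_elim
      case (elim y)
      have "G t y * (\<phi> x - K * norm (x - y)) \<le> G t y * u0 y"
        using lip[of y] elim by (intro mult_left_mono) (auto simp: G_def)
      moreover have "K * (norm (x - y) * G t y) \<le> K * (2 * sqrt t * G (2 * t) y)"
        using norm_mult_gaussian_le[OF t, of "norm (x - y)"] K by (intro mult_left_mono) (auto simp: G_def)
      ultimately show ?case by (simp add: algebra_simps)
    qed
  qed (rule int)
  then have "(4 * pi * t) powr (- real DIM('a) / 2) * (\<phi> x * m t - 2 * K * sqrt t * m (2 * t)) \<le> heat_semigroup t u0 x"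
    unfolding heat_semigroup_def G_def by (intro mult_left_mono) auto
  moreover have "(4 * pi * t) powr (- real DIM('a) / 2) * m t = 1"
    using t by (simp add: m_def flip: powr_add)
  moreover have "m (2 * t) = 2 powr (real DIM('a) / 2) * m t"
    using t by (simp add: m_def mult_ac flip: powr_mult)
  ultimately show ?thesis by (simp add: algebra_simps) (metis (no_types, lifting) mult.left_commute mult.right_neutral)
qed

text \<open>The set where the inequality fails is open and null, hence empty.\<close>

lemma le_of_AE_le:
  fixes g h :: "'a::euclidean_space \<Rightarrow> real"
  assumes "continuous_on UNIV g" "continuous_on UNIV h" "AE x in lebesgue. g x \<le> h x"
  shows "g x \<le> h x"
proof (rule ccontr)
  assume "\<not> g x \<le> h x"
  define S where "S = {x. h x < g x}"
  have "open S" unfolding S_def using assms(1,2) by (intro open_Collect_less)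
  moreover have "x \<in> S" using \<open>\<not> g x \<le> h x\<close> by (simp add: S_def)
  ultimately have "\<not> negligible S" using open_not_negligible by blast
  moreover have "S \<in> null_sets lebesgue"
  proof -
    have "{x \<in> space lebesgue. \<not> g x \<le> h x} = S" by (auto simp: S_def)
    moreover have "S \<in> sets lebesgue" using \<open>open S\<close> by auto
    ultimately show ?thesis using assms(3) AE_iff_null_sets[of S lebesgue]
      by (auto simp: S_def not_less)
  qed
  ultimately show False by (simp add: negligible_iff_null_sets)
qed

text \<open>The error splits into three parts below \<epsilon>/3: \<open>w\<close> against
  \<open>\<phi>\<close>, \<open>\<phi>\<close> against the heat semigroup by the Lipschitz bound,
  and the heat semigroup against \<open>u\<close> by the trace. The last part holds only almost
  everywhere; continuity removes the exceptional set. The result supplies an ordering at a small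
  positive time, from which \<open>radial_comparison\<close> can start.\<close>

lemma eventually_ge_initial_datum:
  fixes u w :: "'a::euclidean_space \<Rightarrow> real \<Rightarrow> real"
  assumes u0: "u0 \<in> Linf" and le: "AE y in lebesgue. \<phi> y \<le> u0 y"
    and lip: "\<And>x y. \<phi> x - K * norm (x - y) \<le> \<phi> y" and K: "K \<ge> 0"
    and trace: "((\<lambda>t. Linf_norm (\<lambda>x. u x t - heat_semigroup t u0 x)) \<longlongrightarrow> 0) (at_right 0)"
    and cont_u: "\<And>t. t > 0 \<Longrightarrow> continuous_on UNIV (\<lambda>x. u x t)"
    and cont_w: "\<And>t. t > 0 \<Longrightarrow> continuous_on UNIV (\<lambda>x. w x t)"
    and w: "\<And>\<epsilon>. \<epsilon> > 0 \<Longrightarrow> eventually (\<lambda>t. \<forall>x. w x t \<le> \<phi> x + \<epsilon>) (at_right 0)"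
    and \<epsilon>: "\<epsilon> > 0"
  shows "eventually (\<lambda>t. \<forall>x. w x t \<le> u x t + \<epsilon>) (at_right 0)"
proof -
  define C where "C = 2 * K * 2 powr (real DIM('a) / 2)"
  have "((\<lambda>t. C * sqrt t) \<longlongrightarrow> C * sqrt 0) (at_right 0)"
    by (intro tendsto_intros)
  then have "eventually (\<lambda>t. C * sqrt t < \<epsilon> / 3) (at_right 0)"
    by (rule order_tendstoD) (use \<epsilon> in auto)
  moreover have "eventually (\<lambda>t. Linf_norm (\<lambda>x. u x t - heat_semigroup t u0 x) < ennreal (\<epsilon> / 3)) (at_right 0)"
    using trace by (rule order_tendstoD) (use \<epsilon> in auto)
  moreover have "eventually (\<lambda>t. \<forall>x. w x t \<le> \<phi> x + \<epsilon> / 3) (at_right 0)"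
    by (rule w) (use \<epsilon> in auto)
  moreover have "eventually (\<lambda>t. t > (0::real)) (at_right 0)"
    by (rule eventually_at_right_less)
  ultimately show ?thesis
  proof eventually_elim
    case (elim t)
    have "AE x in lebesgue. w x t \<le> u x t + \<epsilon>"
      using esssup_AE[of "\<lambda>x. ennreal \<bar>u x t - heat_semigroup t u0 x\<bar>" lebesgue]
    proof eventually_elim
      case (elim x)
      then have "ennreal \<bar>u x t - heat_semigroup t u0 x\<bar> < ennreal (\<epsilon> / 3)"
        using \<open>Linf_norm _ < _\<close> by (simp add: Linf_norm_def)
      then have "\<bar>u x t - heat_semigroup t u0 x\<bar> < \<epsilon> / 3"
        by (simp add: ennreal_less_iff)
      moreover have "\<phi> x - C * sqrt t \<le> heat_semigroup t u0 x"
        using heat_semigroup_ge[OF u0 le lip K \<open>t > 0\<close>, of x] by (simp add: C_def mult_ac)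
      moreover have "w x t \<le> \<phi> x + \<epsilon> / 3" using \<open>\<forall>x. w x t \<le> _\<close> by blast
      ultimately show ?case using \<open>C * sqrt t < \<epsilon> / 3\<close> by linarith
    qed
    then show ?case
      using le_of_AE_le[OF cont_w[OF \<open>t > 0\<close>] continuous_on_add[OF cont_u[OF \<open>t > 0\<close>] continuous_on_const]]
      by blast
  qed
qed

section \<open>The function \<open>F\<close> and its inverse\<close>

locale reaction =
  fixes f f' f'' :: "real \<Rightarrow> real" and q :: real
  assumes f_C1: "\<And>u. u \<ge> 0 \<Longrightarrow> (f has_real_derivative f' u) (at u within {0..})"
    and f'_has_deriv: "\<And>u. u > 0 \<Longrightarrow> (f' has_real_derivative f'' u) (at u)"
    and f_zero: "f 0 = 0"
    and f_pos: "\<And>u. u > 0 \<Longrightarrow> f u > 0"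
    and f'_pos: "\<And>u. u > 0 \<Longrightarrow> f' u > 0"
    and f''_pos: "\<And>u. u > 0 \<Longrightarrow> f'' u > 0"
    and F_finite: "\<And>u. u > 0 \<Longrightarrow> F_tail f u < \<infinity>"
    and q_lim: "((\<lambda>s. f' s * enn2real (F_tail f s)) \<longlongrightarrow> q) (at_right 0)"
begin

lemma f_has_deriv: "u > 0 \<Longrightarrow> (f has_real_derivative f' u) (at u)"
  using f_C1[of u] at_within_interior[of u "{0..}"] by simp

lemma f_continuous: "continuous_on {0..} f"
  using f_C1 by (auto simp: continuous_on_eq_continuous_within intro: DERIV_continuous)

lemma f'_mono: "0 < u \<Longrightarrow> u \<le> v \<Longrightarrow> f' u \<le> f' v"
proof (rule DERIV_nonneg_imp_nondecreasing[of u v f'])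
  fix x assume "0 < u" "u \<le> x"
  then show "\<exists>y. (f' has_real_derivative y) (at x) \<and> 0 \<le> y"
    using f'_has_deriv[of x] f''_pos[of x] by (intro exI[of _ "f'' x"]) auto
qed

lemma f_mono: "0 < u \<Longrightarrow> u \<le> v \<Longrightarrow> f u \<le> f v"
proof (rule DERIV_nonneg_imp_nondecreasing[of u v f])
  fix x assume "0 < u" "u \<le> x"
  then show "\<exists>y. (f has_real_derivative y) (at x) \<and> 0 \<le> y"
    using f_has_deriv[of x] f'_pos[of x] by (intro exI[of _ "f' x"]) auto
qed

lemma f_nonneg: "u \<ge> 0 \<Longrightarrow> f u \<ge> 0"
  using f_pos[of u] f_zero by (cases "u = 0") auto

text \<open>By convexity the largest slope on \<open>[0, M]\<close> is \<open>f' M\<close>, which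
  serves as the constant \<open>L\<close> in the comparison for \<open>blow_up\<close>.\<close>

lemma f_diff_le:
  assumes "0 \<le> u" "u \<le> v" "v \<le> M"
  shows "f v - f u \<le> f' M * (v - u)"
proof (cases "u = v")
  case False
  then have "u < v" using assms by simp
  moreover have "continuous_on {u..v} f"
    by (rule continuous_on_subset[OF f_continuous]) (use assms in auto)
  moreover have "f differentiable (at x)" if "u < x" for x
    using f_has_deriv[of x] that assms by (auto simp: real_differentiable_def)
  ultimately obtain l z where z: "u < z" "z < v" "DERIV f z :> l" "f v - f u = (v - u) * l"
    using MVT[of u v f] by auto
  have "l = f' z" using z(3) f_has_deriv[of z] z(1) assms DERIV_unique by auto
  moreover have "f' z \<le> f' M" using f'_mono z assms by auto
  ultimately show ?thesis using z(4) \<open>u < v\<close> by (simp add: mult.commute)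
qed simp

lemma f_le: "u > 0 \<Longrightarrow> f u \<le> f' u * u"
  using f_diff_le[of 0 u u] by (simp add: f_zero)

text \<open>At \<open>0\<close> the value is \<open>enn2real \<infinity> = 0\<close> instead of
  infinity, so statements about \<open>F\<close> are confined to positive arguments.\<close>

definition F where "F u = enn2real (F_tail f u)"

lemma F_tail_eq: "u > 0 \<Longrightarrow> F_tail f u = ennreal (F u)"
  using F_finite[of u] by (simp add: F_def)

text \<open>The tail integral is split at \<open>b\<close>, the common point of the two intervals
  being null, and the fundamental theorem evaluates the compact piece. Finiteness of the tails
  allows passing from \<open>ennreal\<close> to the reals.\<close>

lemma F_diff:
  assumes a: "0 < a" "a \<le> b"
    and P: "\<And>s. a \<le> s \<Longrightarrow> s \<le> b \<Longrightarrow> (P has_real_derivative 1 / f s) (at s)"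
  shows "F a - F b = P b - P a"
proof -
  \<comment> \<open>Truncation yields a Borel function on the whole line, since \<open>f\<close> is
    controlled only on \<open>[0, \<infinity>)\<close>.\<close>
  define g where "g = (\<lambda>s. indicator {a..} s *\<^sub>R (1 / f s))"
  have [measurable]: "g \<in> borel_measurable borel"
    unfolding g_def using a f_pos
    by (intro borel_measurable_continuous_on_indicator continuous_intros
        continuous_on_subset[OF f_continuous]) (auto, smt (verit))
  have g: "g s = 1 / f s" if "a \<le> s" for s using that by (simp add: g_def)
  have F_tail_g: "F_tail f u = (\<integral>\<^sup>+ s. ennreal (g s) * indicator {u..} s \<partial>lborel)" if "a \<le> u" for u
    using that a unfolding F_tail_def by (auto intro!: nn_integral_cong simp: g split: split_indicator)
  have "F_tail f a = (\<integral>\<^sup>+ s. ennreal (g s) * indicator {a..b} s + ennreal (g s) * indicator {b..} s \<partial>lborel)"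
    unfolding F_tail_g[OF order_refl]
  proof (rule nn_integral_cong_AE)
    show "AE s in lborel. ennreal (g s) * indicator {a..} s
        = ennreal (g s) * indicator {a..b} s + ennreal (g s) * indicator {b..} s"
      using AE_lborel_singleton[of b] by eventually_elim (use a in \<open>auto split: split_indicator\<close>)
  qed
  also have "\<dots> = (\<integral>\<^sup>+ s. ennreal (g s) * indicator {a..b} s \<partial>lborel) + F_tail f b"
    unfolding F_tail_g[OF a(2)] by (rule nn_integral_add) auto
  also have "(\<integral>\<^sup>+ s. ennreal (g s) * indicator {a..b} s \<partial>lborel) = ennreal (P b - P a)"
    by (rule nn_integral_FTC_Icc) (use a P f_pos in \<open>auto simp: g less_imp_le\<close>)
  finally have "ennreal (F a) = ennreal (P b - P a) + ennreal (F b)"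
    using a F_tail_eq by simp
  moreover have "P a \<le> P b"
    by (rule DERIV_nonneg_imp_nondecreasing[of a b P]) (use a P f_pos in \<open>force intro: less_imp_le\<close>)+
  moreover have "F a \<ge> 0" "F b \<ge> 0" by (auto simp: F_def)
  ultimately have "F a = (P b - P a) + F b"
    by (metis diff_ge_0_iff_ge ennreal_inj ennreal_plus add_nonneg_nonneg)
  then show ?thesis by simp
qed

text \<open>Near \<open>u\<close>, \<open>F\<close> is a constant minus a primitive of
  \<open>1 / f\<close>. The nested intervals from \<open>u/4\<close> to \<open>3 * u\<close> and
  from \<open>u/2\<close> to \<open>2 * u\<close> keep every point used in the interior and away
  from \<open>0\<close>.\<close>

lemma F_has_deriv:
  assumes u: "u > 0"
  shows "(F has_real_derivative - (1 / f u)) (at u)"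
proof -
  define P where "P = (\<lambda>x. integral {u/4..x} (\<lambda>s. 1 / f s))"
  have P: "(P has_real_derivative 1 / f s) (at s)" if "s \<in> {u/4<..<3*u}" for s
  proof -
    have "continuous_on {u/4..3*u} (\<lambda>s. 1 / f s)"
      using u f_pos by (intro continuous_intros continuous_on_subset[OF f_continuous]) (auto, smt (verit) divide_pos_pos)
    then have "(P has_real_derivative 1 / f s) (at s within {u/4..3*u})"
      unfolding P_def by (rule integral_has_real_derivative) (use that in auto)
    then show ?thesis using that at_within_interior[of s "{u/4..3*u}"] by simp
  qed
  have "F s = F (u/2) + P (u/2) - P s" if "s \<in> {u/2<..<2*u}" for s
    using F_diff[of "u/2" s P] P that u by auto
  moreover have "((\<lambda>s. F (u/2) + P (u/2) - P s) has_real_derivative - (1 / f u)) (at u)"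
    using P[of u] u by (auto intro!: derivative_eq_intros)
  ultimately show ?thesis
    using u by (elim has_field_derivative_transform_within_open[where S = "{u/2<..<2*u}"]) auto
qed

lemma F_strict_antimono: "0 < u \<Longrightarrow> u < v \<Longrightarrow> F v < F u"
proof (rule DERIV_neg_imp_decreasing[of u v F])
  fix x assume "0 < u" "u \<le> x"
  then show "\<exists>y. (F has_real_derivative y) (at x) \<and> y < 0"
    using F_has_deriv[of x] f_pos[of x] by (intro exI[of _ "- (1 / f x)"]) auto
qed

lemma F_less_iff: "0 < u \<Longrightarrow> 0 < v \<Longrightarrow> F v < F u \<longleftrightarrow> u < v"
  by (metis F_strict_antimono linorder_neqE order_less_asym)

lemma F_inj: "0 < u \<Longrightarrow> 0 < v \<Longrightarrow> F v = F u \<longleftrightarrow> u = v"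
  by (metis F_strict_antimono linorder_neqE order_less_irrefl)

lemma F_pos: "0 < u \<Longrightarrow> 0 < F u"
  using F_strict_antimono[of u "2 * u"] enn2real_nonneg[of "F_tail f (2 * u)"]
  unfolding F_def[symmetric] by linarith

text \<open>Convexity and \<open>f 0 = 0\<close> give f(x) \<le> C x on (0, 1] with C = f'(1). Hence
  \<open>F u + ln u / C\<close> is nonincreasing there, and \<open>F\<close> grows at least like the
  logarithm.\<close>

lemma F_at_0: "filterlim F at_top (at_right 0)"
proof (rule filterlim_at_top_mono)
  define C where "C = f' 1"
  have C: "C > 0" using f'_pos by (simp add: C_def)
  show "filterlim (\<lambda>u. - ln u / C) at_top (at_right 0)"
    using C by real_asymp
  have "- ln u / C \<le> F u" if u: "0 < u" "u < 1" for u
  proof -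
    have "F 1 + ln 1 / C \<le> F u + ln u / C"
    proof (rule DERIV_nonpos_imp_nonincreasing[of u 1 "\<lambda>u. F u + ln u / C"])
      fix x assume x: "u \<le> x" "x \<le> 1"
      have "f x \<le> C * x" using f_le[of x] f'_mono[of x 1] x u
        by (smt (verit) C_def mult_right_mono)
      then have "1 / (C * x) \<le> 1 / f x" using f_pos[of x] x u by (intro divide_left_mono) auto
      then show "\<exists>y. ((\<lambda>u. F u + ln u / C) has_real_derivative y) (at x) \<and> y \<le> 0"
        using x u C by (intro exI[of _ "- (1 / f x) + 1 / (C * x)"])
          (auto intro!: derivative_eq_intros F_has_deriv)
    qed (use u in auto)
    then show ?thesis using F_pos[of 1] by simp
  qed
  then show "eventually (\<lambda>u. - ln u / C \<le> F u) (at_right 0)"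
    using eventually_at_right_real[of 0 1] by (auto elim!: eventually_mono)
qed

lemma f'_at_0: "(f' \<longlongrightarrow> 0) (at_right 0)"
proof -
  have "((\<lambda>s. (f' s * F s) * inverse (F s)) \<longlongrightarrow> q * 0) (at_right 0)"
    using q_lim F_at_0 unfolding F_def[symmetric]
    by (intro tendsto_mult tendsto_inverse_0_at_top)
  moreover have "eventually (\<lambda>s. (f' s * F s) * inverse (F s) = f' s) (at_right 0)"
    using eventually_at_right_less[of 0] by eventually_elim (use F_pos in force)
  ultimately show ?thesis by (simp add: tendsto_cong)
qed

section \<open>The inverse of \<open>F\<close> and its decay\<close>

text \<open>This is the domain of \<open>\<Psi>\<close>. It is upward closed, and the arguments at
  which the barriers evaluate \<open>\<Psi>\<close> always stay above some fixed value of
  \<open>F\<close>.\<close>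

definition F_range where "F_range = F ` {0<..}"

definition \<Psi> where "\<Psi> = the_inv_into {0<..} F"

lemma \<Psi>_F: "u > 0 \<Longrightarrow> \<Psi> (F u) = u"
  unfolding \<Psi>_def by (rule the_inv_into_f_f) (auto simp: inj_on_def F_inj)

lemma F_in_F_range: "u > 0 \<Longrightarrow> F u \<in> F_range" by (simp add: F_range_def)

lemma \<Psi>_pos: "y \<in> F_range \<Longrightarrow> \<Psi> y > 0" and F_\<Psi>: "y \<in> F_range \<Longrightarrow> F (\<Psi> y) = y"
  by (auto simp: F_range_def \<Psi>_F)

lemma F_range_pos: "y \<in> F_range \<Longrightarrow> y > 0"
  using F_pos by (auto simp: F_range_def)

text \<open>\<open>F\<close> is unbounded near \<open>0\<close> and continuous, so the intermediate
  value theorem reaches every larger value.\<close>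

lemma F_range_upward:
  assumes "y \<in> F_range" "y \<le> z"
  shows "z \<in> F_range"
proof -
  obtain v where v: "v > 0" "y = F v" using assms by (auto simp: F_range_def)
  have "eventually (\<lambda>u. F u \<ge> z \<and> u < v \<and> u > 0) (at_right 0)"
    using F_at_0 v eventually_at_right_less[of 0] eventually_at_right_real[of 0 v]
    by (auto simp: filterlim_at_top eventually_conj_iff elim: eventually_mono)
  then obtain u where u: "F u \<ge> z" "u < v" "u > 0"
    using eventually_happens'[OF trivial_limit_at_right_real] by blast
  have "\<exists>x\<ge>u. x \<le> v \<and> F x = z"
  proof (rule IVT2)
    have "isCont F x" if "u \<le> x" for x
      using F_has_deriv[of x] DERIV_isCont u(3) that by (meson less_le_trans)
    then show "\<forall>x. u \<le> x \<and> x \<le> v \<longrightarrow> isCont F x" by blast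
  qed (use u v assms in auto)
  then show ?thesis using u by (auto simp: F_range_def)
qed

lemma \<Psi>_le_iff: "y \<in> F_range \<Longrightarrow> u > 0 \<Longrightarrow> \<Psi> y \<le> u \<longleftrightarrow> F u \<le> y"
  using F_less_iff[of u "\<Psi> y"] \<Psi>_pos[of y] F_\<Psi>[of y] by (simp add: not_less[symmetric])

lemma \<Psi>_antimono: "y \<in> F_range \<Longrightarrow> y \<le> z \<Longrightarrow> \<Psi> z \<le> \<Psi> y"
  using \<Psi>_le_iff[of z "\<Psi> y"] F_range_upward[of y z] \<Psi>_pos[of y] F_\<Psi>[of y] by auto

text \<open>F' = -1/f inverts to \<Psi>' = -f(\<Psi>); thus t \<mapsto> \<Psi>(T - t) solves the
  ordinary differential equation u' = f(u).\<close>

lemma \<Psi>_has_deriv: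
  assumes y: "y \<in> F_range"
  shows "(\<Psi> has_real_derivative - f (\<Psi> y)) (at y)"
proof -
  define u where "u = \<Psi> y"
  have u: "u > 0" "F u = y" using y \<Psi>_pos F_\<Psi> by (auto simp: u_def)
  have "isCont \<Psi> (F u)"
  proof (rule isCont_inverse_function[where f = F and d = "u/2"])
    fix z assume "\<bar>z - u\<bar> \<le> u / 2"
    then have "z > 0" using u(1) by linarith
    then show "\<Psi> (F z) = z" "isCont F z" using \<Psi>_F DERIV_isCont[OF F_has_deriv] by auto
  qed (use u in auto)
  then have "(\<Psi> has_real_derivative inverse (- (1 / f u))) (at y)"
  proof (intro DERIV_inverse_function[where f = F and a = "F (2 * u)" and b = "y + 1"])
    show "F (\<Psi> z) = z" if "F (2 * u) < z" for z
      using that F_range_upward[OF F_in_F_range[of "2 * u"]] u F_\<Psi> by auto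
  qed (use F_has_deriv[OF u(1)] f_pos[OF u(1)] F_strict_antimono[of u "2 * u"] u u_def in auto)
  then show ?thesis by (simp add: u_def)
qed

lemma f\<Psi>_has_deriv:
  assumes y: "y \<in> F_range"
  shows "((\<lambda>y. f (\<Psi> y)) has_real_derivative - f' (\<Psi> y) * f (\<Psi> y)) (at y)"
  using DERIV_chain2[OF f_has_deriv[OF \<Psi>_pos[OF y]] \<Psi>_has_deriv[OF y]] by simp

lemma f\<Psi>_antimono: "y \<in> F_range \<Longrightarrow> y \<le> z \<Longrightarrow> f (\<Psi> z) \<le> f (\<Psi> y)"
  by (intro f_mono \<Psi>_antimono \<Psi>_pos) (rule F_range_upward)

lemma f'\<Psi>_antimono: "y \<in> F_range \<Longrightarrow> y \<le> z \<Longrightarrow> f' (\<Psi> z) \<le> f' (\<Psi> y)"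
  by (intro f'_mono \<Psi>_antimono \<Psi>_pos) (rule F_range_upward)

text \<open>By the mean value theorem the drop is (z - y) times \<open>f (\<Psi> \<xi>)\<close> at
  an intermediate point, and \<open>f \<circ> \<Psi>\<close> is smallest at the right end. This
  gives both the Lipschitz bound of the barrier and the gain from shifting its argument by
  one.\<close>

lemma \<Psi>_diff_ge:
  assumes y: "y \<in> F_range" and z: "y \<le> z"
  shows "f (\<Psi> z) * (z - y) \<le> \<Psi> y - \<Psi> z"
proof (cases "y = z")
  case False
  then have "y < z" using z by simp
  then obtain \<xi> where \<xi>: "y < \<xi>" "\<xi> < z" "\<Psi> z - \<Psi> y = (z - y) * - f (\<Psi> \<xi>)"
    using MVT2[of y z \<Psi> "\<lambda>y. - f (\<Psi> y)"] \<Psi>_has_deriv F_range_upward[OF y] by auto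
  have "f (\<Psi> z) \<le> f (\<Psi> \<xi>)" using f\<Psi>_antimono F_range_upward[OF y] \<xi> by auto
  then have "f (\<Psi> z) * (z - y) \<le> f (\<Psi> \<xi>) * (z - y)" using z by (intro mult_right_mono) auto
  also have "\<dots> = \<Psi> y - \<Psi> z" using \<xi>(3) by (simp add: algebra_simps)
  finally show ?thesis .
qed simp

text \<open>Since \<open>f' \<le> \<epsilon>\<close> below \<open>\<Psi> a\<close>, both \<open>\<Psi>\<close> and \<open>f \<circ> \<Psi>\<close> have logarithmic derivative at least \<open>-\<epsilon>\<close> beyond \<open>a\<close>.\<close>

lemma \<Psi>_exp_decay:
  assumes a: "a \<in> F_range" and \<epsilon>: "f' (\<Psi> a) \<le> \<epsilon>" and y: "a \<le> y"
  shows "\<Psi> a * exp (- \<epsilon> * (y - a)) \<le> \<Psi> y" (is ?A)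
    and "f (\<Psi> a) * exp (- \<epsilon> * (y - a)) \<le> f (\<Psi> y)" (is ?B)
proof -
  \<comment> \<open>Gronwall argument shared by both claims.\<close>
  have *: "g a * exp (- \<epsilon> * (y - a)) \<le> g y"
    if g: "\<And>x. x \<in> F_range \<Longrightarrow> a \<le> x \<Longrightarrow> (g has_real_derivative g' x) (at x)"
      "\<And>x. x \<in> F_range \<Longrightarrow> a \<le> x \<Longrightarrow> - \<epsilon> * g x \<le> g' x" for g g' :: "real \<Rightarrow> real"
  proof -
    have "g a * exp (\<epsilon> * (a - a)) \<le> g y * exp (\<epsilon> * (y - a))"
    proof (rule DERIV_nonneg_imp_nondecreasing[of a y "\<lambda>x. g x * exp (\<epsilon> * (x - a))"])
      fix x assume "a \<le> x" "x \<le> y"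
      then have x: "x \<in> F_range" "a \<le> x" using F_range_upward[OF a] by auto
      have "(g' x + \<epsilon> * g x) * exp (\<epsilon> * (x - a)) \<ge> 0" using g(2)[OF x] by simp
      then show "\<exists>d. ((\<lambda>x. g x * exp (\<epsilon> * (x - a))) has_real_derivative d) (at x) \<and> d \<ge> 0"
        by (intro exI[of _ "(g' x + \<epsilon> * g x) * exp (\<epsilon> * (x - a))"] conjI)
          (auto intro!: derivative_eq_intros g(1)[OF x] simp: algebra_simps)
    qed (use y in auto)
    then have "g a * exp (- \<epsilon> * (y - a)) \<le> g y * exp (\<epsilon> * (y - a)) * exp (- \<epsilon> * (y - a))"
      by (intro mult_right_mono) auto
    then show ?thesis by (simp add: mult.assoc flip: exp_add)
  qed
  have e: "f' (\<Psi> x) \<le> \<epsilon>" if "a \<le> x" for x using f'\<Psi>_antimono[OF a that] \<epsilon> by simp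
  show ?A
  proof (rule *[of \<Psi> "\<lambda>x. - f (\<Psi> x)"])
    fix x assume x: "x \<in> F_range" "a \<le> x"
    then have "f (\<Psi> x) \<le> f' (\<Psi> x) * \<Psi> x" using f_le \<Psi>_pos by auto
    also have "\<dots> \<le> \<epsilon> * \<Psi> x" using e[OF x(2)] \<Psi>_pos[OF x(1)] by (intro mult_right_mono) auto
    finally show "- \<epsilon> * \<Psi> x \<le> - f (\<Psi> x)" by simp
  qed (rule \<Psi>_has_deriv)
  show ?B
  proof (rule *[of "\<lambda>x. f (\<Psi> x)" "\<lambda>x. - f' (\<Psi> x) * f (\<Psi> x)"])
    fix x assume x: "x \<in> F_range" "a \<le> x"
    have "f' (\<Psi> x) * f (\<Psi> x) \<le> \<epsilon> * f (\<Psi> x)"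
      using e[OF x(2)] f_pos[OF \<Psi>_pos[OF x(1)]] by (intro mult_right_mono) auto
    then show "- \<epsilon> * f (\<Psi> x) \<le> - f' (\<Psi> x) * f (\<Psi> x)" by simp
  qed (rule f\<Psi>_has_deriv)
qed

lemma ex_f'\<Psi>_le:
  assumes "\<epsilon> > 0"
  obtains a where "a \<in> F_range" "a \<ge> b" "f' (\<Psi> a) \<le> \<epsilon>"
proof -
  have "eventually (\<lambda>u. f' u < \<epsilon> \<and> F u \<ge> b \<and> u > 0) (at_right 0)"
    using order_tendstoD(2)[OF f'_at_0 assms] F_at_0 eventually_at_right_less[of 0]
    by (auto simp: filterlim_at_top eventually_conj_iff)
  then obtain u where "f' u < \<epsilon>" "F u \<ge> b" "u > 0"
    using eventually_happens'[OF trivial_limit_at_right_real] by blast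
  then show thesis by (intro that[of "F u"]) (auto simp: F_in_F_range \<Psi>_F)
qed

section \<open>Subsolutions\<close>

text \<open>The argument of \<open>\<Psi>\<close> decreases in time at rate \<theta> = 1 - 2N/G,
  which is positive by the assumption on \<open>G\<close>. At the origin the subsolution climbs to a
  level above an a priori bound of \<open>u\<close>, and comparison contradicts that bound.\<close>

lemma blow_up:
  fixes u :: "'a::euclidean_space \<Rightarrow> real \<Rightarrow> real"
  assumes C21: "C21 u"
    and eq: "\<And>x t. t > 0 \<Longrightarrow> deriv (u x) t = laplacian (\<lambda>y. u y t) x + f (u x t)"
    and nonneg: "\<And>x t. t > 0 \<Longrightarrow> 0 \<le> u x t"
    and bdd: "\<And>T. T > 0 \<Longrightarrow> bounded ((\<lambda>(x, t). u x t) ` (UNIV \<times> {0<..<T}))"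
    and t1: "t1 > 0" and b: "b \<in> F_range" and G: "G > 2 * real DIM('a)"
    and init: "\<And>x. \<Psi> (b + (norm x)\<^sup>2 / G) \<le> u x t1"
  shows False
proof -
  define N where "N = real DIM('a)"
  have N: "N > 0" by (simp add: N_def)
  have G0: "G > 0" "G > 2 * N" using G N by (auto simp: N_def)
  define \<theta> where "\<theta> = 1 - 2 * N / G"
  have \<theta>: "\<theta> > 0" using G0 by (simp add: \<theta>_def)
  \<comment> \<open>At time t1 + b/\<theta> the argument at the origin would reach \<open>0\<close>.
    The bound \<open>B\<close> on \<open>u\<close> can therefore be fixed up to \<open>T\<close>
    before the level \<open>c\<close> and its hitting time \<open>t2\<close> are chosen.\<close>
  define T where "T = t1 + b / \<theta> + 1"
  have bpos: "b > 0" by (rule F_range_pos[OF b])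
  have "T > 0" using t1 bpos \<theta> by (simp add: T_def add_pos_pos)
  then obtain B where "\<forall>y\<in>(\<lambda>(x, t). u x t) ` (UNIV \<times> {0<..<T}). norm y \<le> B"
    using bdd[of T] unfolding bounded_iff by blast
  then have B: "u x t \<le> B" if "0 < t" "t < T" for x t
    using that by (auto simp: abs_le_iff)
  have "b / \<theta> > 0" using bpos \<theta> by simp
  then have "B \<ge> 0" using B[OF t1, of 0] nonneg[OF t1, of 0] by (simp add: T_def)
  \<comment> \<open>Exceeding \<open>B\<close> yields the contradiction; exceeding
    \<open>\<Psi> b\<close> gives \<open>F c < b\<close>, so that \<open>c\<close> is reached
    strictly after \<open>t1\<close>.\<close>
  define c where "c = B + 1 + \<Psi> b"
  have c: "c > 0" "c > B" "c > \<Psi> b" using \<open>B \<ge> 0\<close> \<Psi>_pos[OF b] by (auto simp: c_def)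
  have ylt: "F c < b" using F_strict_antimono[OF \<Psi>_pos[OF b] c(3)] F_\<Psi>[OF b] by simp
  define t2 where "t2 = t1 + (b - F c) / \<theta>"
  have "(b - F c) / \<theta> \<le> b / \<theta>" using \<theta> F_pos[OF c(1)] by (intro divide_right_mono) auto
  then have t2: "t1 < t2" "t2 < T" using ylt \<theta> by (auto simp: t2_def T_def)
  define v where "v = (\<lambda>\<rho> t. b + \<rho> / G - \<theta> * (t - t1))"
  have v_ge: "v \<rho> t \<ge> F c" if "\<rho> \<ge> 0" "t \<le> t2" for \<rho> t
  proof -
    have "\<theta> * (t - t1) \<le> \<theta> * (t2 - t1)" using that \<theta> by (intro mult_left_mono) auto
    also have "\<dots> = b - F c" using \<theta> by (simp add: t2_def)
    finally show ?thesis using that G0 zero_le_divide_iff[of \<rho> G] unfolding v_def by linarith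
  qed
  have vY: "v \<rho> t \<in> F_range" if "\<rho> \<ge> 0" "t \<le> t2" for \<rho> t
    using F_range_upward[OF F_in_F_range[OF c(1)] v_ge[OF that]] .
  have v\<rho>: "((\<lambda>\<rho>. v \<rho> t) has_real_derivative 1 / G) (at \<rho>)" for \<rho> t
    unfolding v_def using G0 by (auto intro!: derivative_eq_intros)
  have vt: "(v \<rho> has_real_derivative - \<theta>) (at t)" for \<rho> t
    unfolding v_def using G0 by (auto intro!: derivative_eq_intros)
  have le_c: "\<Psi> (v \<rho> t) \<le> c" if "\<rho> \<ge> 0" "t \<le> t2" for \<rho> t
    using \<Psi>_antimono[OF F_in_F_range[OF c(1)] v_ge[OF that]] \<Psi>_F[OF c(1)] by simp
  have "\<Psi> (v ((norm (0::'a))\<^sup>2) t2) \<le> u 0 t2"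
  proof (rule radial_comparison[where H = "\<lambda>\<rho> t. \<Psi> (v \<rho> t)" and a = t1 and b = t2 and B = c
        and ?H1.0 = "\<lambda>\<rho> t. - f (\<Psi> (v \<rho> t)) / G"
        and ?H2.0 = "\<lambda>\<rho> t. f' (\<Psi> (v \<rho> t)) * f (\<Psi> (v \<rho> t)) / G\<^sup>2"
        and Ht = "\<lambda>\<rho> t. \<theta> * f (\<Psi> (v \<rho> t))" and f = f and L = "f' c", OF C21 eq nonneg t1])
    fix \<rho> t assume \<rho>: "(0::real) \<le> \<rho>" and t: "t1 < t" "t \<le> t2"
    note Y = vY[OF \<rho> t(2)]
    show "((\<lambda>\<rho>. \<Psi> (v \<rho> t)) has_real_derivative - f (\<Psi> (v \<rho> t)) / G) (at \<rho>)"
      using DERIV_chain2[OF \<Psi>_has_deriv[OF Y] v\<rho>] by simp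
    show "((\<lambda>t. \<Psi> (v \<rho> t)) has_real_derivative \<theta> * f (\<Psi> (v \<rho> t))) (at t)"
      using DERIV_chain2[OF \<Psi>_has_deriv[OF Y] vt] by (simp add: mult.commute)
    show "((\<lambda>\<rho>. - f (\<Psi> (v \<rho> t)) / G) has_real_derivative f' (\<Psi> (v \<rho> t)) * f (\<Psi> (v \<rho> t)) / G\<^sup>2) (at \<rho>)"
      using DERIV_cdivide[OF DERIV_minus[OF DERIV_chain2[OF f\<Psi>_has_deriv[OF Y] v\<rho>]], of G]
      by (simp add: power2_eq_square)
  next
    have "continuous_on F_range \<Psi>"
      using \<Psi>_has_deriv DERIV_isCont continuous_at_imp_continuous_on by blast
    then have "continuous_on ({0..} \<times> {t1..t2}) (\<lambda>p. \<Psi> (v (fst p) (snd p)))"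
      by (rule continuous_on_compose2) (use vY G0 in \<open>auto simp: v_def intro!: continuous_intros\<close>)
    then show "continuous_on ({0..} \<times> {t1..t2}) (\<lambda>(\<rho>, t). \<Psi> (v \<rho> t))"
      by (simp add: case_prod_beta)
  next
    fix x :: 'a and t assume t: "t1 < t" "t \<le> t2" and lt: "u x t < \<Psi> (v ((norm x)\<^sup>2) t)"
    define \<rho> where "\<rho> = (norm x)\<^sup>2"
    define U where "U = \<Psi> (v \<rho> t)"
    have U: "U > 0" "U \<le> c" using \<Psi>_pos[OF vY] le_c t by (auto simp: U_def \<rho>_def)
    have "f U - f (u x t) \<le> f' c * (U - u x t)"
      using f_diff_le[of "u x t" U c] nonneg[of t x] t1 t lt U by (simp add: U_def \<rho>_def)
    moreover have "4 * \<rho> * (f' U * f U / G\<^sup>2) \<ge> 0"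
      using f'_pos[OF U(1)] f_pos[OF U(1)] by (simp add: \<rho>_def)
    \<comment> \<open>The choice of \<open>\<theta>\<close> balances time derivative, source and
      first-order radial term exactly; the second-order radial term is nonnegative and is
      dropped.\<close>
    moreover have "\<theta> * f U = f U + 2 * N * (- f U / G)" by (simp add: \<theta>_def algebra_simps)
    ultimately show "\<theta> * f (\<Psi> (v ((norm x)\<^sup>2) t)) \<le> 4 * (norm x)\<^sup>2 * (f' (\<Psi> (v ((norm x)\<^sup>2) t)) * f (\<Psi> (v ((norm x)\<^sup>2) t)) / G\<^sup>2)
        + 2 * real DIM('a) * (- f (\<Psi> (v ((norm x)\<^sup>2) t)) / G) + f (u x t) + f' c * (\<Psi> (v ((norm x)\<^sup>2) t) - u x t)"
      unfolding N_def[symmetric] \<rho>_def[symmetric] U_def[symmetric] by linarith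
  next
    show "\<Psi> (v ((norm x)\<^sup>2) t1) \<le> u x t1" for x using init by (simp add: v_def)
    show "f' c \<ge> 0" using f'_pos[OF c(1)] by simp
    show "t2 \<in> {t1..t2}" using t2 by simp
  qed (use le_c in auto)
  moreover have "v ((norm (0::'a))\<^sup>2) t2 = F c" using \<theta> by (simp add: v_def t2_def)
  ultimately have "c \<le> u 0 t2" using \<Psi>_F[OF c(1)] by simp
  then show False using B[of t2 0] t2 t1 c(2) by simp
qed

section \<open>A heat subsolution with Gaussian correction\<close>

text \<open>This is the heat kernel at time \<delta> + t as a function of \<rho> = |x|^2, divided by
  its value at \<rho> = 0, t = 0. Writing the power of (\<delta> + t)/\<delta> inside the
  exponential reduces differentiation to one chain rule.\<close>

definition gaussian_profile :: "real \<Rightarrow> real \<Rightarrow> real \<Rightarrow> real \<Rightarrow> real" where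
  "gaussian_profile N \<delta> \<rho> t = exp (- \<rho> / (4 * (\<delta> + t)) - N / 2 * ln ((\<delta> + t) / \<delta>))"

text \<open>The argument of \<open>\<Psi>\<close> solves the heat equation, both its time derivative
  and its Laplacian being 2N/G; since \<open>\<Psi>\<close> is convex, the first term is a
  subsolution.\<close>

definition barrier :: "real \<Rightarrow> real \<Rightarrow> real \<Rightarrow> real \<Rightarrow> real \<Rightarrow> real \<Rightarrow> real \<Rightarrow> real" where
  "barrier N G a M \<delta> \<rho> t = \<Psi> (a + (\<rho> + 2 * N * t) / G) - M * gaussian_profile N \<delta> \<rho> t"

lemma gaussian_profile_has_deriv:
  assumes "\<delta> > 0" "t \<ge> 0"
  shows "((\<lambda>\<rho>. gaussian_profile N \<delta> \<rho> t) has_real_derivative - gaussian_profile N \<delta> \<rho> t / (4 * (\<delta> + t))) (at \<rho>)"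
    and "(gaussian_profile N \<delta> \<rho> has_real_derivative
      gaussian_profile N \<delta> \<rho> t * (\<rho> / (4 * (\<delta> + t)\<^sup>2) - N / (2 * (\<delta> + t)))) (at t)"
proof -
  define s where "s = \<delta> + t"
  have s: "s > 0" using assms by (simp add: s_def)
  have "((\<lambda>\<rho>. - \<rho> / (4 * s) - N / 2 * ln (s / \<delta>)) has_real_derivative - (1 / (4 * s))) (at \<rho>)"
    using s by (auto intro!: derivative_eq_intros)
  from DERIV_chain2[OF DERIV_exp this]
  show "((\<lambda>\<rho>. gaussian_profile N \<delta> \<rho> t) has_real_derivative - gaussian_profile N \<delta> \<rho> t / (4 * (\<delta> + t))) (at \<rho>)"
    by (simp add: gaussian_profile_def s_def)
  have "((\<lambda>s. - \<rho> / (4 * s)) has_real_derivative \<rho> / (4 * s\<^sup>2)) (at s)"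
    using s by (auto intro!: derivative_eq_intros simp: power2_eq_square field_simps)
  then have "((\<lambda>s. - \<rho> / (4 * s)) has_real_derivative \<rho> / (4 * s\<^sup>2)) (at (\<delta> + t))"
    by (simp add: s_def)
  moreover have "((\<lambda>t. \<delta> + t) has_real_derivative 1) (at t)"
    by (auto intro!: derivative_eq_intros)
  ultimately have "((\<lambda>t. - \<rho> / (4 * (\<delta> + t))) has_real_derivative \<rho> / (4 * s\<^sup>2) * 1) (at t)"
    by (rule DERIV_chain2)
  then have "((\<lambda>t. - \<rho> / (4 * (\<delta> + t))) has_real_derivative \<rho> / (4 * s\<^sup>2)) (at t)"
    by simp
  moreover have "((\<lambda>t. N / 2 * ln ((\<delta> + t) / \<delta>)) has_real_derivative N / (2 * s)) (at t)"
    using s assms unfolding s_def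
    by (auto intro!: derivative_eq_intros simp: field_simps)
  ultimately have "((\<lambda>t. - \<rho> / (4 * (\<delta> + t)) - N / 2 * ln ((\<delta> + t) / \<delta>)) has_real_derivative
      \<rho> / (4 * s\<^sup>2) - N / (2 * s)) (at t)"
    by (rule DERIV_diff)
  from DERIV_chain2[OF DERIV_exp this]
  show "(gaussian_profile N \<delta> \<rho> has_real_derivative
      gaussian_profile N \<delta> \<rho> t * (\<rho> / (4 * (\<delta> + t)\<^sup>2) - N / (2 * (\<delta> + t)))) (at t)"
    unfolding gaussian_profile_def s_def .
qed

lemma gaussian_profile_pos: "gaussian_profile N \<delta> \<rho> t > 0"
  by (simp add: gaussian_profile_def)

context
  fixes N G a M \<delta> :: real
  assumes par: "N \<ge> 1" "G > 0" "a \<in> F_range" "M \<ge> 0" "\<delta> > 0"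
begin

private abbreviation "v \<rho> t \<equiv> a + (\<rho> + 2 * N * t) / G"
private abbreviation "H \<equiv> barrier N G a M \<delta>"
private abbreviation "g \<equiv> gaussian_profile N \<delta>"

lemma v_in_F_range: "\<rho> \<ge> 0 \<Longrightarrow> t \<ge> 0 \<Longrightarrow> v \<rho> t \<in> F_range"
  by (rule F_range_upward[OF par(3)]) (use par in auto)

lemma barrier_le_\<Psi>: "\<rho> \<ge> 0 \<Longrightarrow> t \<ge> 0 \<Longrightarrow> H \<rho> t \<le> \<Psi> a"
proof -
  assume "\<rho> \<ge> 0" "t \<ge> 0"
  then have "\<Psi> (v \<rho> t) \<le> \<Psi> a" by (intro \<Psi>_antimono) (use par in auto)
  moreover have "M * g \<rho> t \<ge> 0" using par gaussian_profile_pos[of N \<delta> \<rho> t] by simp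
  ultimately show ?thesis by (simp add: barrier_def)
qed

lemma \<Psi>v_has_deriv:
  assumes "\<rho> \<ge> 0" "t \<ge> 0"
  shows "((\<lambda>\<rho>. \<Psi> (v \<rho> t)) has_real_derivative - f (\<Psi> (v \<rho> t)) / G) (at \<rho>)"
    and "((\<lambda>\<rho>. f (\<Psi> (v \<rho> t))) has_real_derivative - f' (\<Psi> (v \<rho> t)) * f (\<Psi> (v \<rho> t)) / G) (at \<rho>)"
    and "((\<lambda>t. \<Psi> (v \<rho> t)) has_real_derivative - 2 * N * f (\<Psi> (v \<rho> t)) / G) (at t)"
proof -
  note Y = v_in_F_range[OF assms]
  have v\<rho>: "((\<lambda>\<rho>. v \<rho> t) has_real_derivative 1 / G) (at \<rho>)"
    using par by (auto intro!: derivative_eq_intros)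
  have vt: "((\<lambda>t. v \<rho> t) has_real_derivative 2 * N / G) (at t)"
    using par by (auto intro!: derivative_eq_intros)
  show "((\<lambda>\<rho>. \<Psi> (v \<rho> t)) has_real_derivative - f (\<Psi> (v \<rho> t)) / G) (at \<rho>)"
    using DERIV_chain2[OF \<Psi>_has_deriv[OF Y] v\<rho>] by simp
  show "((\<lambda>\<rho>. f (\<Psi> (v \<rho> t))) has_real_derivative - f' (\<Psi> (v \<rho> t)) * f (\<Psi> (v \<rho> t)) / G) (at \<rho>)"
    using DERIV_chain2[OF f\<Psi>_has_deriv[OF Y] v\<rho>] by simp
  show "((\<lambda>t. \<Psi> (v \<rho> t)) has_real_derivative - 2 * N * f (\<Psi> (v \<rho> t)) / G) (at t)"
    using DERIV_chain2[OF \<Psi>_has_deriv[OF Y] vt] by (simp add: mult_ac)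
qed

lemma barrier_continuous: "continuous_on ({0..} \<times> {0..}) (\<lambda>p. H (fst p) (snd p))"
proof -
  have "continuous_on F_range \<Psi>"
    using \<Psi>_has_deriv DERIV_isCont continuous_at_imp_continuous_on by blast
  moreover have "G \<noteq> 0" using par by simp
  ultimately have "continuous_on ({0..} \<times> {0..}) (\<lambda>p. \<Psi> (v (fst p) (snd p)))"
    by (elim continuous_on_compose2) (use v_in_F_range \<open>G \<noteq> 0\<close> in \<open>auto intro!: continuous_intros\<close>)
  then show ?thesis
    unfolding barrier_def gaussian_profile_def
    using par by (intro continuous_intros) (auto simp: add_pos_nonneg less_imp_neq[symmetric])
qed

text \<open>The radial derivative is bounded. Its first part is controlled by r \<le> 1 + r^2, where
  \<open>\<Psi>_diff_ge\<close> bounds r^2 f(\<Psi>(v)) by G \<Psi>(a); the Gaussian part is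
  controlled by \<open>norm_mult_gaussian_le\<close>.\<close>

lemma barrier_lipschitz:
  obtains K where "K \<ge> 0"
    "\<And>x y :: 'a::euclidean_space. H ((norm x)\<^sup>2) 0 - K * norm (x - y) \<le> H ((norm y)\<^sup>2) 0"
proof -
  define K where "K = 2 * (f (\<Psi> a) + G * \<Psi> a) / G + M * sqrt \<delta> / \<delta>"
  define p' where "p' = (\<lambda>r. (- f (\<Psi> (v (r\<^sup>2) 0)) / G + M * g (r\<^sup>2) 0 / (4 * \<delta>)) * (2 * r))"
  have fa: "f (\<Psi> a) > 0" "\<Psi> a > 0" using par f_pos \<Psi>_pos by auto
  have deriv: "((\<lambda>r. H (r\<^sup>2) 0) has_real_derivative p' r) (at r)" for r
  proof -
    have "((\<lambda>\<rho>. H \<rho> 0) has_real_derivative - f (\<Psi> (v (r\<^sup>2) 0)) / G + M * g (r\<^sup>2) 0 / (4 * \<delta>)) (at (r\<^sup>2))"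
      unfolding barrier_def
      using DERIV_diff[OF \<Psi>v_has_deriv(1)[of "r\<^sup>2" 0] DERIV_cmult[OF gaussian_profile_has_deriv(1)[of \<delta> 0 N "r\<^sup>2"], of M]] par
      by simp
    moreover have "((\<lambda>r. r\<^sup>2) has_real_derivative 2 * r) (at r)"
      by (auto intro!: derivative_eq_intros)
    ultimately show ?thesis unfolding p'_def by (rule DERIV_chain2)
  qed
  have bound: "norm (p' r) \<le> K" if r: "r \<ge> 0" for r
  proof -
    define y where "y = f (\<Psi> (v (r\<^sup>2) 0))"
    have vY: "v (r\<^sup>2) 0 \<in> F_range" by (rule v_in_F_range) auto
    have y0: "y \<ge> 0" using f_pos[OF \<Psi>_pos[OF vY]] by (simp add: y_def)
    have av: "a \<le> v (r\<^sup>2) 0" using par by simp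
    have "y * (r\<^sup>2 / G) \<le> \<Psi> a - \<Psi> (v (r\<^sup>2) 0)"
      using \<Psi>_diff_ge[OF par(3) av] by (simp add: y_def)
    also have "\<dots> \<le> \<Psi> a" using \<Psi>_pos[OF vY] by simp
    finally have 1: "y * r\<^sup>2 \<le> G * \<Psi> a" using par by (simp add: field_simps)
    have 2: "y \<le> f (\<Psi> a)" unfolding y_def by (rule f\<Psi>_antimono[OF par(3) av])
    have "r \<le> 1 + r\<^sup>2" using zero_le_power2[of "r - 1"] r by (simp add: power2_eq_square algebra_simps)
    then have "y * r \<le> y * (1 + r\<^sup>2)" using y0 by (rule mult_left_mono)
    then have yr: "y * r \<le> f (\<Psi> a) + G * \<Psi> a" using 1 2 by (simp add: algebra_simps)
    have "r * g (r\<^sup>2) 0 \<le> 2 * sqrt \<delta> * exp (- r\<^sup>2 / (8 * \<delta>))"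
      using norm_mult_gaussian_le[OF par(5), of r] par by (simp add: gaussian_profile_def)
    also have "\<dots> \<le> 2 * sqrt \<delta>" using par by simp
    finally have "M * (r * g (r\<^sup>2) 0) \<le> M * (2 * sqrt \<delta>)" using par by (intro mult_left_mono) auto
    then have "M * (r * g (r\<^sup>2) 0) / (2 * \<delta>) \<le> M * (2 * sqrt \<delta>) / (2 * \<delta>)"
      using par by (intro divide_right_mono) auto
    moreover have "2 * (y * r) / G \<le> 2 * (f (\<Psi> a) + G * \<Psi> a) / G"
      using yr par by (intro divide_right_mono mult_left_mono) auto
    moreover have "p' r = M * (r * g (r\<^sup>2) 0) / (2 * \<delta>) - 2 * (y * r) / G"
      using par by (simp add: p'_def y_def field_simps)
    moreover have "M * (r * g (r\<^sup>2) 0) / (2 * \<delta>) \<ge> 0" "2 * (y * r) / G \<ge> 0"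
      using par r y0 gaussian_profile_pos[of N \<delta> "r\<^sup>2" 0] by (auto intro!: mult_nonneg_nonneg divide_nonneg_nonneg)
    ultimately show ?thesis by (simp add: K_def abs_le_iff)
  qed
  show thesis
  proof (rule that[of K])
    show "K \<ge> 0" using bound[of 0] norm_ge_zero order_trans by blast
    fix x y :: 'a
    have "norm (H ((norm x)\<^sup>2) 0 - H ((norm y)\<^sup>2) 0) \<le> K * norm (norm x - norm y)"
      by (rule field_differentiable_bound[of "{0..}" "\<lambda>r. H (r\<^sup>2) 0" p'])
        (use deriv bound in \<open>auto intro: has_field_derivative_at_within\<close>)
    also have "\<dots> \<le> K * norm (x - y)"
      using \<open>K \<ge> 0\<close> norm_triangle_ineq3[of x y] by (intro mult_left_mono) auto
    finally show "H ((norm x)\<^sup>2) 0 - K * norm (x - y) \<le> H ((norm y)\<^sup>2) 0" by (simp add: abs_le_iff)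
  qed
qed

text \<open>Uniformity in \<rho> comes from monotonicity: the \<open>\<Psi>\<close> term decreases
  in time, and widening the Gaussian only raises it, so it loses at most the amplitude factor
  \<open>E t\<close>.\<close>

lemma barrier_initial:
  assumes "\<epsilon> > 0"
  shows "eventually (\<lambda>t. \<forall>\<rho>\<ge>0. H \<rho> t \<le> H \<rho> 0 + \<epsilon>) (at_right 0)"
proof -
  define E where "E = (\<lambda>t. exp (- (N / 2 * ln ((\<delta> + t) / \<delta>))))"
  have "((\<lambda>t. M * (1 - E t)) \<longlongrightarrow> M * (1 - E 0)) (at_right 0)"
    unfolding E_def using par by (intro tendsto_intros) auto
  then have "eventually (\<lambda>t. M * (1 - E t) < \<epsilon>) (at_right 0)"
    by (rule order_tendstoD) (use assms par in \<open>auto simp: E_def\<close>)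
  then show ?thesis using eventually_at_right_less[of 0]
  proof eventually_elim
    case (elim t)
    show ?case
    proof (intro allI impI)
      fix \<rho> :: real assume \<rho>: "\<rho> \<ge> 0"
      have g0: "g \<rho> 0 = exp (- \<rho> / (4 * \<delta>))" using par by (simp add: gaussian_profile_def)
      have gt: "g \<rho> t = exp (- \<rho> / (4 * (\<delta> + t))) * E t"
        by (simp add: gaussian_profile_def E_def flip: exp_add)
      have "\<rho> / (4 * (\<delta> + t)) \<le> \<rho> / (4 * \<delta>)" using \<rho> elim par by (intro divide_left_mono) auto
      then have "g \<rho> 0 * E t \<le> g \<rho> t"
        unfolding g0 gt by (intro mult_right_mono) (auto simp: E_def)
      then have "g \<rho> 0 - g \<rho> t \<le> g \<rho> 0 * (1 - E t)" by (simp add: algebra_simps)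
      also have "\<dots> \<le> 1 * (1 - E t)"
      proof (rule mult_right_mono)
        show "g \<rho> 0 \<le> 1" using \<rho> par by (simp add: g0)
        have "ln ((\<delta> + t) / \<delta>) \<ge> 0" using elim par by (intro ln_ge_zero) auto
        then show "0 \<le> 1 - E t" using par by (simp add: E_def)
      qed
      finally have "M * (g \<rho> 0 - g \<rho> t) \<le> M * (1 - E t)"
        using par by (simp add: mult_left_mono)
      moreover have "\<Psi> (v \<rho> t) \<le> \<Psi> (v \<rho> 0)"
        by (rule \<Psi>_antimono[OF v_in_F_range]) (use \<rho> elim par in \<open>auto intro!: divide_right_mono\<close>)
      ultimately show "H \<rho> t \<le> H \<rho> 0 + \<epsilon>"
        using elim by (simp add: barrier_def algebra_simps)
    qed
  qed
qed

text \<open>The ordering is obtained up to \<epsilon> at a small time \<open>s\<close>, carried from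
  \<open>s\<close> to \<open>t\<close> by \<open>radial_comparison\<close>, and \<epsilon> is
  removed at the end. Lowering the barrier by \<epsilon> leaves it a heat subsolution, and the
  source f(u) is nonnegative, so \<open>L = 0\<close> suffices.\<close>

lemma barrier_le_solution:
  fixes u :: "'a::euclidean_space \<Rightarrow> real \<Rightarrow> real"
  assumes N: "N = real DIM('a)" and C21: "C21 u"
    and eq: "\<And>x t. t > 0 \<Longrightarrow> deriv (u x) t = laplacian (\<lambda>y. u y t) x + f (u x t)"
    and nonneg: "\<And>x t. t > 0 \<Longrightarrow> 0 \<le> u x t"
    and u0: "u0 \<in> Linf"
    and trace: "((\<lambda>t. Linf_norm (\<lambda>x. u x t - heat_semigroup t u0 x)) \<longlongrightarrow> 0) (at_right 0)"
    and le: "AE y in lebesgue. H ((norm y)\<^sup>2) 0 \<le> u0 y"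
    and t: "t > 0"
  shows "H ((norm x)\<^sup>2) t \<le> u x t"
proof (rule field_le_epsilon)
  fix \<epsilon> :: real assume \<epsilon>: "\<epsilon> > 0"
  obtain K where K: "K \<ge> 0"
    "\<And>x y :: 'a. H ((norm x)\<^sup>2) 0 - K * norm (x - y) \<le> H ((norm y)\<^sup>2) 0"
    using barrier_lipschitz by blast
  have "eventually (\<lambda>s. \<forall>x. H ((norm x)\<^sup>2) s \<le> u x s + \<epsilon>) (at_right 0)"
  proof (rule eventually_ge_initial_datum[OF u0 le K(2,1) trace _ _ _ \<epsilon>])
    fix s :: real assume s: "s > 0"
    have "continuous_on (UNIV \<times> {0<..}) (\<lambda>(x, t). u x t)" using C21 by (simp add: C21_def)
    then have "continuous_on UNIV (\<lambda>x. (\<lambda>(x, t). u x t) (x, s))"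
      by (rule continuous_on_compose2) (use s in \<open>auto intro!: continuous_intros\<close>)
    then show "continuous_on UNIV (\<lambda>x. u x s)" by simp
    have "continuous_on UNIV (\<lambda>x::'a. (\<lambda>p. H (fst p) (snd p)) ((norm x)\<^sup>2, s))"
      by (rule continuous_on_compose2[OF barrier_continuous]) (use s in \<open>auto intro!: continuous_intros\<close>)
    then show "continuous_on UNIV (\<lambda>x::'a. H ((norm x)\<^sup>2) s)" by simp
  next
    fix \<epsilon> :: real assume "\<epsilon> > 0"
    show "eventually (\<lambda>t. \<forall>x::'a. H ((norm x)\<^sup>2) t \<le> H ((norm x)\<^sup>2) 0 + \<epsilon>) (at_right 0)"
      using barrier_initial[OF \<open>\<epsilon> > 0\<close>] by (auto elim: eventually_mono)
  qed
  then have "eventually (\<lambda>s. (\<forall>x. H ((norm x)\<^sup>2) s \<le> u x s + \<epsilon>) \<and> s \<in> {0<..<t}) (at_right 0)"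
    using eventually_at_right_real[OF t] by (rule eventually_conj)
  from eventually_happens'[OF trivial_limit_at_right_real this]
  obtain s where s: "0 < s" "s < t" "\<And>x. H ((norm x)\<^sup>2) s \<le> u x s + \<epsilon>"
    by auto
  define \<psi> where "\<psi> = (\<lambda>\<rho> t. \<Psi> (v \<rho> t))"
  have "H ((norm x)\<^sup>2) t - \<epsilon> \<le> u x t"
  proof (rule radial_comparison[where H = "\<lambda>\<rho> t. H \<rho> t - \<epsilon>" and a = s and b = t and B = "\<Psi> a"
        and ?H1.0 = "\<lambda>\<rho> t. - f (\<psi> \<rho> t) / G + M * g \<rho> t / (4 * (\<delta> + t))"
        and ?H2.0 = "\<lambda>\<rho> t. f' (\<psi> \<rho> t) * f (\<psi> \<rho> t) / G\<^sup>2 - M * g \<rho> t / (16 * (\<delta> + t)\<^sup>2)"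
        and Ht = "\<lambda>\<rho> t. - 2 * N * f (\<psi> \<rho> t) / G - M * g \<rho> t * (\<rho> / (4 * (\<delta> + t)\<^sup>2) - N / (2 * (\<delta> + t)))"
        and f = f and L = 0, OF C21 eq nonneg s(1)])
    fix \<rho> r assume \<rho>: "(0::real) \<le> \<rho>" and r': "s < r" "r \<le> t"
    then have r: "r \<ge> 0" using s by simp
    have pos: "\<delta> + r > 0" using r par by simp
    note \<psi> = \<Psi>v_has_deriv[OF \<rho> r, folded \<psi>_def]
    note g = gaussian_profile_has_deriv[OF par(5) r, of N \<rho>]
    show "((\<lambda>\<rho>. H \<rho> r - \<epsilon>) has_real_derivative - f (\<psi> \<rho> r) / G + M * g \<rho> r / (4 * (\<delta> + r))) (at \<rho>)"
      unfolding barrier_def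
      using DERIV_diff[OF DERIV_diff[OF \<psi>(1) DERIV_cmult[OF g(1), of M]] DERIV_const[of \<epsilon>]]
      by (simp add: \<psi>_def)
    show "((\<lambda>t. H \<rho> t - \<epsilon>) has_real_derivative
        - 2 * N * f (\<psi> \<rho> r) / G - M * g \<rho> r * (\<rho> / (4 * (\<delta> + r)\<^sup>2) - N / (2 * (\<delta> + r)))) (at r)"
      unfolding barrier_def
      using DERIV_diff[OF DERIV_diff[OF \<psi>(3) DERIV_cmult[OF g(2), of M]] DERIV_const[of \<epsilon>]]
      by (simp add: \<psi>_def mult.assoc)
    show "((\<lambda>\<rho>. - f (\<psi> \<rho> r) / G + M * g \<rho> r / (4 * (\<delta> + r))) has_real_derivative
        f' (\<psi> \<rho> r) * f (\<psi> \<rho> r) / G\<^sup>2 - M * g \<rho> r / (16 * (\<delta> + r)\<^sup>2)) (at \<rho>)"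
    proof -
      have *: "- (- k / G) / G + M * (- l / (4 * s)) / (4 * s) = k / G\<^sup>2 - M * l / (16 * s\<^sup>2)" for k l s :: real
        by (simp add: power2_eq_square)
      have "- (- f' (\<psi> \<rho> r) * f (\<psi> \<rho> r) / G) / G + M * (- g \<rho> r / (4 * (\<delta> + r))) / (4 * (\<delta> + r))
          = f' (\<psi> \<rho> r) * f (\<psi> \<rho> r) / G\<^sup>2 - M * g \<rho> r / (16 * (\<delta> + r)\<^sup>2)"
        using *[of "f' (\<psi> \<rho> r) * f (\<psi> \<rho> r)" "g \<rho> r" "\<delta> + r"] by (simp only: mult_minus_left)
      then show ?thesis
        unfolding \<psi>_def
        by (intro DERIV_cong[OF DERIV_add[OF DERIV_cdivide[OF DERIV_minus[OF \<psi>(2)]]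
              DERIV_cdivide[OF DERIV_cmult[OF g(1)]]], unfolded \<psi>_def])
    qed
  next
    have "continuous_on ({0..} \<times> {s..t}) (\<lambda>p. H (fst p) (snd p) - \<epsilon>)"
      by (intro continuous_intros continuous_on_subset[OF barrier_continuous]) (use s in auto)
    then show "continuous_on ({0..} \<times> {s..t}) (\<lambda>(\<rho>, t). H \<rho> t - \<epsilon>)"
      by (simp add: case_prod_beta)
  next
    show "H \<rho> r - \<epsilon> \<le> \<Psi> a" if "0 \<le> \<rho>" "r \<in> {s..t}" for \<rho> r
      using barrier_le_\<Psi>[of \<rho> r] that s \<epsilon> by auto
    show "H ((norm x)\<^sup>2) s - \<epsilon> \<le> u x s" for x using s(3)[of x] by simp
    show "t \<in> {s..t}" using s by simp
  next
    fix x :: 'a and r assume r: "s < r" "r \<le> t"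
    define \<rho> where "\<rho> = (norm x)\<^sup>2"
    have "\<psi> \<rho> r > 0" unfolding \<psi>_def by (rule \<Psi>_pos[OF v_in_F_range]) (use r s in \<open>auto simp: \<rho>_def\<close>)
    then have "4 * \<rho> * (f' (\<psi> \<rho> r) * f (\<psi> \<rho> r) / G\<^sup>2) \<ge> 0"
      using f_pos f'_pos by (simp add: \<rho>_def less_imp_le)
    moreover have "f (u x r) \<ge> 0" using nonneg[of r x] r s by (intro f_nonneg) auto
    \<comment> \<open>This identity is the heat equation for the Gaussian term.\<close>
    moreover have "- m * (\<rho> / (4 * S) - N / (2 * s)) = - 4 * \<rho> * (m / (16 * S)) + 2 * N * (m / (4 * s))"
      for m S s :: real
      by (cases "S = 0"; cases "s = 0") (simp_all add: field_simps)
    from this[of "M * g \<rho> r" "(\<delta> + r)\<^sup>2" "\<delta> + r"]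
    have "- M * g \<rho> r * (\<rho> / (4 * (\<delta> + r)\<^sup>2) - N / (2 * (\<delta> + r)))
        = - 4 * \<rho> * (M * g \<rho> r / (16 * (\<delta> + r)\<^sup>2)) + 2 * N * (M * g \<rho> r / (4 * (\<delta> + r)))"
      by (simp only: mult_minus_left)
    ultimately show "- 2 * N * f (\<psi> ((norm x)\<^sup>2) r) / G
          - M * g ((norm x)\<^sup>2) r * ((norm x)\<^sup>2 / (4 * (\<delta> + r)\<^sup>2) - N / (2 * (\<delta> + r)))
        \<le> 4 * (norm x)\<^sup>2 * (f' (\<psi> ((norm x)\<^sup>2) r) * f (\<psi> ((norm x)\<^sup>2) r) / G\<^sup>2
            - M * g ((norm x)\<^sup>2) r / (16 * (\<delta> + r)\<^sup>2))
          + 2 * real DIM('a) * (- f (\<psi> ((norm x)\<^sup>2) r) / G + M * g ((norm x)\<^sup>2) r / (4 * (\<delta> + r)))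
          + f (u x r) + 0 * (H ((norm x)\<^sup>2) r - \<epsilon> - u x r)"
      unfolding N[symmetric] \<rho>_def[symmetric] by (simp add: algebra_simps)
  qed auto
  then show "H ((norm x)\<^sup>2) t \<le> u x t + \<epsilon>" by simp
qed

end

section \<open>Choice of the barrier parameters\<close>

text \<open>At time \<open>t1\<close> the Gaussian is at most a multiple of e(\<rho>)^2, while
  \<open>\<Psi>\<close> and \<open>f \<circ> \<Psi>\<close> decay no faster than a multiple of
  e(\<rho>). The correction thus costs at most a fixed fraction of \<open>\<Psi>\<close> everywhere,
  and far out less than a unit shift of its argument.\<close>

lemma ex_barrier_ge:
  assumes N: "N \<ge> 1" and G: "G > 0" and \<delta>: "\<delta> > 0"
  obtains a M t1 b where "a \<in> F_range" "M \<ge> 0" "t1 > 0" "b \<in> F_range"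
    "\<And>\<rho>. 0 \<le> \<rho> \<Longrightarrow> \<rho> \<le> \<delta> \<Longrightarrow> barrier N G a M \<delta> \<rho> 0 \<le> 0"
    "\<And>\<rho>. 0 \<le> \<rho> \<Longrightarrow> \<Psi> (b + \<rho> / G) \<le> barrier N G a M \<delta> \<rho> t1"
proof -
  \<comment> \<open>Along v(\<rho>), decay at rate \<epsilon> is exp (-\<rho> / (128 \<delta> N)) up
    to a constant, which for N \<ge> 1 is no faster than e(\<rho>).\<close>
  define \<epsilon> where "\<epsilon> = G / (128 * \<delta> * N)"
  have \<epsilon>: "\<epsilon> > 0" using assms by (simp add: \<epsilon>_def)
  obtain a where a: "a \<in> F_range" "f' (\<Psi> a) \<le> \<epsilon>" using ex_f'\<Psi>_le[OF \<epsilon>] by metis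
  \<comment> \<open>With this factor the Gaussian term at time \<open>0\<close> is still at least
    \<open>\<Psi> a\<close> at \<rho> = \<delta>.\<close>
  define M where "M = \<Psi> a * exp (1 / 4)"
  \<comment> \<open>Now (\<delta> + t1)/\<delta> = 16, so the Gaussian amplitude has dropped to
    4^(-N) \<le> 1/4. This outweighs exp (1/4) \<le> 2.\<close>
  define t1 where "t1 = 15 * \<delta>"
  define v where "v = (\<lambda>\<rho>. a + (\<rho> + 2 * N * t1) / G)"
  define g where "g = (\<lambda>\<rho>. M * gaussian_profile N \<delta> \<rho> t1)"
  define e where "e = (\<lambda>\<rho>. exp (- \<rho> / (128 * \<delta>)))"
  have barrier: "barrier N G a M \<delta> \<rho> t1 = \<Psi> (v \<rho>) - g \<rho>" for \<rho>
    by (simp add: barrier_def v_def g_def)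
  have \<Psi>a: "\<Psi> a > 0" "f (\<Psi> a) > 0" using a \<Psi>_pos f_pos by auto
  have t1: "t1 > 0" using \<delta> by (simp add: t1_def)
  have v_ge: "v \<rho> \<ge> a" if "\<rho> \<ge> 0" for \<rho> using that assms t1 by (simp add: v_def)
  have vY: "v \<rho> \<in> F_range" if "\<rho> \<ge> 0" for \<rho> using F_range_upward[OF a(1) v_ge[OF that]] .
  have e_le: "e \<rho> \<le> 1" if "\<rho> \<ge> 0" for \<rho> using that \<delta> by (simp add: e_def)
  have e_pos: "e \<rho> > 0" for \<rho> by (simp add: e_def)
  have g_le: "g \<rho> \<le> \<Psi> a / 2 * (e \<rho> * e \<rho>)" if "\<rho> \<ge> 0" for \<rho>
  proof -
    have exp14: "exp (1 / 4 :: real) \<le> 2"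
      using exp_bound[of "1 / 4 :: real"] by (simp add: power2_eq_square)
    have "ln 16 = 2 * ln (4::real)" using ln_realpow[of "4::real" 2] by simp
    then have "exp (- (N / 2 * ln 16)) = exp (- (N * ln 4))" by simp
    also have "\<dots> \<le> exp (- ln 4)" using N by simp
    also have "\<dots> = (1 / 4 :: real)" by (simp add: exp_minus)
    finally have 1: "exp (- (N / 2 * ln 16)) \<le> (1 / 4 :: real)" .
    have "(\<delta> + t1) / \<delta> = 16" "4 * (\<delta> + t1) = 64 * \<delta>" using \<delta> by (auto simp: t1_def)
    then have "gaussian_profile N \<delta> \<rho> t1 = exp (- \<rho> / (64 * \<delta>)) * exp (- (N / 2 * ln 16))"
      by (simp add: gaussian_profile_def flip: exp_add)
    also have "exp (- \<rho> / (64 * \<delta>)) = e \<rho> * e \<rho>"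
      by (simp add: e_def flip: exp_add)
    finally have "g \<rho> = \<Psi> a * (e \<rho> * e \<rho>) * (exp (1 / 4) * exp (- (N / 2 * ln 16)))"
      by (simp add: g_def M_def)
    also have "\<dots> \<le> \<Psi> a * (e \<rho> * e \<rho>) * (2 * (1 / 4))"
      using \<Psi>a e_pos[of \<rho>] 1 exp14 by (intro mult_left_mono mult_mono) auto
    finally show ?thesis by simp
  qed
  have decay: "e \<rho> * (3 / 4) \<le> exp (- \<epsilon> * (v \<rho> - a))" if "\<rho> \<ge> 0" for \<rho>
  proof -
    have "\<epsilon> * (v \<rho> - a) = \<rho> / (128 * \<delta> * N) + 30 / 128"
      using assms by (simp add: \<epsilon>_def v_def t1_def field_simps)
    also have "\<dots> \<le> \<rho> / (128 * \<delta>) + 1 / 4"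
      using assms that by (intro add_mono divide_left_mono) auto
    finally have "exp (- \<rho> / (128 * \<delta>) + - (1 / 4)) \<le> exp (- \<epsilon> * (v \<rho> - a))" by simp
    moreover have "(3 / 4 :: real) \<le> exp (- (1 / 4))"
      using exp_ge_add_one_self[of "- (1 / 4) :: real"] by simp
    then have "e \<rho> * (3 / 4) \<le> e \<rho> * exp (- (1 / 4))" using e_pos[of \<rho>] by (intro mult_left_mono) auto
    moreover have "exp (- \<rho> / (128 * \<delta>) + - (1 / 4)) = e \<rho> * exp (- (1 / 4))"
      unfolding e_def by (rule exp_add)
    ultimately show ?thesis by linarith
  qed
  have near: "barrier N G a M \<delta> \<rho> t1 \<ge> \<Psi> (v \<rho>) / 3" if "\<rho> \<ge> 0" for \<rho>
  proof -
    have "\<Psi> a * (e \<rho> * (3 / 4)) \<le> \<Psi> a * exp (- \<epsilon> * (v \<rho> - a))"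
      using decay[OF that] \<Psi>a by (intro mult_left_mono) auto
    also have "\<dots> \<le> \<Psi> (v \<rho>)" using \<Psi>_exp_decay(1)[OF a v_ge[OF that]] by simp
    finally have 1: "\<Psi> a * (e \<rho> * (3 / 4)) \<le> \<Psi> (v \<rho>)" .
    have "\<Psi> a / 2 * (e \<rho> * e \<rho>) \<le> \<Psi> a / 2 * (e \<rho> * 1)"
      using \<Psi>a e_pos[of \<rho>] e_le[OF that] by (intro mult_left_mono) auto
    then have "g \<rho> \<le> 2 / 3 * \<Psi> (v \<rho>)" using 1 g_le[OF that] by (simp add: algebra_simps)
    then show ?thesis by (simp add: barrier)
  qed
  \<comment> \<open>\<open>c * e \<rho>\<close> bounds \<open>f (\<Psi> (v \<rho> + 1))\<close> from
    below; the factor \<open>exp (- \<epsilon>)\<close> accounts for the unit shift.\<close>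
  define c where "c = f (\<Psi> a) * (3 / 4) * exp (- \<epsilon>)"
  have c: "c > 0" using \<Psi>a by (simp add: c_def)
  \<comment> \<open>From here on \<Psi>(a) e(\<rho>) / 2 \<le> c, so the extra factor e(\<rho>) of
    the Gaussian makes it smaller than the drop of \<open>\<Psi>\<close> over one unit.\<close>
  define \<rho>0 where "\<rho>0 = max 0 (128 * \<delta> * ln (\<Psi> a / (2 * c)))"
  have far: "barrier N G a M \<delta> \<rho> t1 \<ge> \<Psi> (v \<rho> + 1)" if "\<rho> \<ge> \<rho>0" for \<rho>
  proof -
    have \<rho>: "\<rho> \<ge> 0" using that by (simp add: \<rho>0_def)
    have "ln (\<Psi> a / (2 * c)) \<le> \<rho> / (128 * \<delta>)"
      using that \<delta> by (simp add: \<rho>0_def field_simps)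
    then have "exp (ln (\<Psi> a / (2 * c))) \<le> exp (\<rho> / (128 * \<delta>))" by simp
    moreover have "exp (ln (\<Psi> a / (2 * c))) = \<Psi> a / (2 * c)" using \<Psi>a c by simp
    ultimately have "\<Psi> a / (2 * c) \<le> exp (\<rho> / (128 * \<delta>))" by simp
    then have "\<Psi> a / 2 * e \<rho> \<le> c" using c by (simp add: e_def exp_minus field_simps)
    then have "\<Psi> a / 2 * e \<rho> * e \<rho> \<le> c * e \<rho>" using e_pos[of \<rho>] by (intro mult_right_mono) auto
    then have "g \<rho> \<le> c * e \<rho>" using g_le[OF \<rho>] by (simp add: mult.assoc)
    also have "\<dots> = f (\<Psi> a) * exp (- \<epsilon>) * (e \<rho> * (3 / 4))" by (simp add: c_def)
    also have "\<dots> \<le> f (\<Psi> a) * exp (- \<epsilon>) * exp (- \<epsilon> * (v \<rho> - a))"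
      using decay[OF \<rho>] \<Psi>a by (intro mult_left_mono) auto
    also have "\<dots> = f (\<Psi> a) * exp (- \<epsilon> * (v \<rho> + 1 - a))"
      by (simp add: algebra_simps flip: exp_add)
    also have "\<dots> \<le> f (\<Psi> (v \<rho> + 1))" using \<Psi>_exp_decay(2)[OF a, of "v \<rho> + 1"] v_ge[OF \<rho>] by simp
    also have "\<dots> \<le> \<Psi> (v \<rho>) - \<Psi> (v \<rho> + 1)" using \<Psi>_diff_ge[OF vY[OF \<rho>], of "v \<rho> + 1"] by simp
    finally show ?thesis by (simp add: barrier)
  qed
  have \<rho>0: "\<rho>0 \<ge> 0" by (simp add: \<rho>0_def)
  \<comment> \<open>On the bounded range \<rho> \<le> \<rho>0 the factor 1/3 is turned into a shift:
    \<Psi>(y) is a third of the least value of \<Psi>(v) there.\<close>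
  define y where "y = F (\<Psi> (v \<rho>0) / 3)"
  have third: "\<Psi> (v \<rho>0) / 3 > 0" using \<Psi>_pos[OF vY[OF \<rho>0]] by simp
  have yY: "y \<in> F_range" using F_in_F_range[OF third] by (simp add: y_def)
  \<comment> \<open>The first entry serves \<rho> < \<rho>0, the second the far region.\<close>
  define b where "b = max y (v 0 + 1)"
  show thesis
  proof (rule that[of a M t1 b])
    show "a \<in> F_range" "t1 > 0" by fact+
    show "M \<ge> 0" using \<Psi>a by (simp add: M_def)
    show bY: "b \<in> F_range" by (rule F_range_upward[OF yY]) (simp add: b_def)
    show "barrier N G a M \<delta> \<rho> 0 \<le> 0" if \<rho>: "0 \<le> \<rho>" "\<rho> \<le> \<delta>" for \<rho>
    proof -
      have "\<Psi> (a + (\<rho> + 2 * N * 0) / G) \<le> \<Psi> a" using \<rho> G by (intro \<Psi>_antimono[OF a(1)]) auto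
      moreover have "M * gaussian_profile N \<delta> \<rho> 0 = \<Psi> a * exp (1 / 4 - \<rho> / (4 * \<delta>))"
        using \<delta> by (simp add: M_def gaussian_profile_def flip: exp_add)
      moreover have "\<rho> / (4 * \<delta>) \<le> 1 / 4" using \<rho> \<delta> by (simp add: field_simps)
      then have "\<Psi> a * 1 \<le> \<Psi> a * exp (1 / 4 - \<rho> / (4 * \<delta>))"
        using \<Psi>a by (intro mult_left_mono) auto
      ultimately show ?thesis by (simp add: barrier_def)
    qed
    show "\<Psi> (b + \<rho> / G) \<le> barrier N G a M \<delta> \<rho> t1" if \<rho>: "0 \<le> \<rho>" for \<rho>
    proof (cases "\<rho> \<ge> \<rho>0")
      case True
      have "v \<rho> + 1 \<le> b + \<rho> / G" by (simp add: b_def v_def add_divide_distrib)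
      moreover have "v \<rho> + 1 \<in> F_range" by (rule F_range_upward[OF vY[OF \<rho>]]) simp
      ultimately have "\<Psi> (b + \<rho> / G) \<le> \<Psi> (v \<rho> + 1)" by (intro \<Psi>_antimono)
      then show ?thesis using far[OF True] by simp
    next
      case False
      have "\<Psi> (b + \<rho> / G) \<le> \<Psi> y" using \<rho> G by (intro \<Psi>_antimono[OF yY]) (simp add: b_def add_increasing2)
      also have "\<dots> = \<Psi> (v \<rho>0) / 3" unfolding y_def by (rule \<Psi>_F[OF third])
      also have "\<dots> \<le> \<Psi> (v \<rho>) / 3"
        using \<Psi>_antimono[OF vY[OF \<rho>], of "v \<rho>0"] False G by (simp add: v_def divide_right_mono)
      finally show ?thesis using near[OF \<rho>] by simp
    qed
  qed
qed

text \<open>Taking \<delta> = R^2 makes the region \<rho> \<le> \<delta> the ball of radius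
  \<open>R\<close>. Inside it the initial barrier is nonpositive; outside, \<open>a > 0\<close> and
  monotonicity of \<open>\<Psi>\<close> put it below the datum. The barrier then yields the lower
  bound at \<open>t1\<close> from which \<open>blow_up\<close> starts.\<close>

lemma no_global_solution:
  fixes u0 :: "'a::euclidean_space \<Rightarrow> real"
  assumes u0: "u0 \<in> Linf" "AE x in lebesgue. 0 \<le> u0 x"
    and G: "G > 2 * real DIM('a)" and R: "R > 0"
    and far: "AE x in lebesgue. R \<le> norm x \<longrightarrow> 0 < u0 x \<and> F (u0 x) \<le> (norm x)\<^sup>2 / G"
  shows "\<not> global_solution f u0 u"
proof
  assume "global_solution f u0 u"
  then have u: "C21 u" "\<And>x t. t > 0 \<Longrightarrow> 0 \<le> u x t"
    "\<And>T. T > 0 \<Longrightarrow> bounded ((\<lambda>(x, t). u x t) ` (UNIV \<times> {0<..<T}))"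
    "\<And>x t. t > 0 \<Longrightarrow> deriv (u x) t = laplacian (\<lambda>y. u y t) x + f (u x t)"
    "((\<lambda>t. Linf_norm (\<lambda>x. u x t - heat_semigroup t u0 x)) \<longlongrightarrow> 0) (at_right 0)"
    unfolding global_solution_def by blast+
  define N where "N = real DIM('a)"
  have N: "N \<ge> 1" using DIM_positive[where 'a = 'a] by (simp add: N_def Suc_le_eq)
  have G0: "G > 0" using G N by (simp add: N_def)
  have \<delta>: "R\<^sup>2 > 0" using R by simp
  obtain a M t1 b where b: "a \<in> F_range" "M \<ge> 0" "t1 > 0" "b \<in> F_range"
    "\<And>\<rho>. 0 \<le> \<rho> \<Longrightarrow> \<rho> \<le> R\<^sup>2 \<Longrightarrow> barrier N G a M (R\<^sup>2) \<rho> 0 \<le> 0"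
    "\<And>\<rho>. 0 \<le> \<rho> \<Longrightarrow> \<Psi> (b + \<rho> / G) \<le> barrier N G a M (R\<^sup>2) \<rho> t1"
    using ex_barrier_ge[OF N G0 \<delta>] by blast
  have "AE x in lebesgue. barrier N G a M (R\<^sup>2) ((norm x)\<^sup>2) 0 \<le> u0 x"
    using u0(2) far
  proof eventually_elim
    case (elim x)
    show ?case
    proof (cases "R \<le> norm x")
      case True
      then have x: "0 < u0 x" "F (u0 x) \<le> (norm x)\<^sup>2 / G" using elim by auto
      have aY: "a + (norm x)\<^sup>2 / G \<in> F_range" by (rule F_range_upward[OF b(1)]) (use G0 in simp)
      have "barrier N G a M (R\<^sup>2) ((norm x)\<^sup>2) 0 \<le> \<Psi> (a + (norm x)\<^sup>2 / G)"
        using b(2) gaussian_profile_pos[of N "R\<^sup>2" "(norm x)\<^sup>2" 0] by (simp add: barrier_def)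
      also have "\<dots> \<le> u0 x" using \<Psi>_le_iff[OF aY x(1)] x(2) F_range_pos[OF b(1)] by simp
      finally show ?thesis .
    next
      case False
      then have "(norm x)\<^sup>2 \<le> R\<^sup>2" by (intro power_mono) auto
      then show ?thesis using b(5)[of "(norm x)\<^sup>2"] elim by simp
    qed
  qed
  then have "barrier N G a M (R\<^sup>2) ((norm x)\<^sup>2) t1 \<le> u x t1" for x
    by (intro barrier_le_solution[OF N G0 b(1,2) \<delta> N_def u(1) u(4,2) u0(1) u(5) _ b(3)])
  then have "\<Psi> (b + (norm x)\<^sup>2 / G) \<le> u x t1" for x
    using b(6)[of "(norm x)\<^sup>2"] order_trans by fastforce
  then show False
    using blow_up[OF u(1) u(4,2,3) b(3,4) G] by blast
qed

end

section \<open>From the limit inferior to a bound outside a ball\<close>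

text \<open>An event of the infimum filter splits into one at infinity, which yields
  \<open>R\<close>, and one holding almost everywhere.\<close>

lemma Liminf_ae_at_infinity_gtD:
  fixes g :: "'a::euclidean_space \<Rightarrow> ennreal"
  assumes "c < Liminf ae_at_infinity g"
  obtains R where "R > 0" "AE x in lebesgue. R \<le> norm x \<longrightarrow> c < g x"
proof -
  have "eventually (\<lambda>x. c < g x) ae_at_infinity"
    using assms le_Liminf_iff[of "Liminf ae_at_infinity g" ae_at_infinity g] by blast
  then obtain P Q where "eventually P at_infinity" and Q: "AE x in lebesgue. Q x"
    and PQ: "\<And>x. P x \<Longrightarrow> Q x \<Longrightarrow> c < g x"
    unfolding ae_at_infinity_def eventually_inf by blast
  then obtain R where R: "R > 0" "\<And>x. norm x \<ge> R \<Longrightarrow> P x"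
    unfolding eventually_at_infinity_pos by blast
  have "AE x in lebesgue. R \<le> norm x \<longrightarrow> c < g x"
    using Q by eventually_elim (use R(2) PQ in blast)
  with R(1) show thesis by (rule that)
qed

theorem theorem1p3:
  fixes f f' f'' :: "real \<Rightarrow> real" and q :: real
  assumes f_C1: "\<And>u. u \<ge> 0 \<Longrightarrow> (f has_real_derivative f' u) (at u within {0..})"
                "continuous_on {0..} f'"
    and f_C2: "\<And>u. u > 0 \<Longrightarrow> (f' has_real_derivative f'' u) (at u)"
              "continuous_on {0<..} f''"
    and f_zero: "f 0 = 0"
    and f_pos: "\<And>u. u > 0 \<Longrightarrow> f u > 0"
    and f'_pos: "\<And>u. u > 0 \<Longrightarrow> f' u > 0"
    and f''_pos: "\<And>u. u > 0 \<Longrightarrow> f'' u > 0"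
    and F_finite: "\<And>u. u > 0 \<Longrightarrow> F_tail f u < \<infinity>"
    and q_lim: "((\<lambda>s. f' s * enn2real (F_tail f s)) \<longlongrightarrow> q) (at_right 0)"
    and q_one: "q = 1 \<Longrightarrow> \<exists>s0>0. \<forall>s. 0 < s \<and> s < s0 \<longrightarrow> f' s * enn2real (F_tail f s) \<ge> 1"
  shows "\<exists>\<Gamma>::real. \<Gamma> > 0 \<and>
    (\<forall>u0 :: 'a::euclidean_space \<Rightarrow> real.
       u0 \<in> Linf \<and> (AE x in lebesgue. 0 \<le> u0 x) \<and>
       Liminf ae_at_infinity (\<lambda>x. ennreal ((norm x)\<^sup>2) / F_tail f (u0 x)) \<ge> ennreal \<Gamma>
       \<longrightarrow> \<not> (\<exists>u. global_solution f u0 u))"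
proof -
  interpret reaction f f' f'' q
    by unfold_locales fact+
  define N where "N = real DIM('a)"
  have N: "N > 0" by (simp add: N_def)
  show ?thesis
  \<comment> \<open>The limit inferior controls only levels strictly below 4N. The level G = 3N is
    used, which still exceeds the 2N required for blow-up.\<close>
  proof (intro exI[of _ "4 * N"] conjI allI impI notI)
    show "4 * N > 0" using N by simp
    fix u0 :: "'a \<Rightarrow> real"
    assume u0: "u0 \<in> Linf \<and> (AE x in lebesgue. 0 \<le> u0 x) \<and>
       Liminf ae_at_infinity (\<lambda>x. ennreal ((norm x)\<^sup>2) / F_tail f (u0 x)) \<ge> ennreal (4 * N)"
      and "\<exists>u. global_solution f u0 u"
    then obtain u where u: "global_solution f u0 u" by blast
    have "ennreal (3 * N) < ennreal (4 * N)" using N by (simp add: ennreal_less_iff)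
    also have "\<dots> \<le> Liminf ae_at_infinity (\<lambda>x. ennreal ((norm x)\<^sup>2) / F_tail f (u0 x))"
      using u0 by blast
    finally obtain R where R: "R > 0"
      "AE x in lebesgue. R \<le> norm x \<longrightarrow> ennreal (3 * N) < ennreal ((norm x)\<^sup>2) / F_tail f (u0 x)"
      by (rule Liminf_ae_at_infinity_gtD)
    have "AE x in lebesgue. 0 \<le> u0 x" using u0 by blast
    with R(2) have "AE x in lebesgue. R \<le> norm x \<longrightarrow> 0 < u0 x \<and> F (u0 x) \<le> (norm x)\<^sup>2 / (3 * N)"
    proof eventually_elim
      case (elim x)
      show ?case
      proof
        assume "R \<le> norm x"
        then have gt: "ennreal (3 * N) < ennreal ((norm x)\<^sup>2) / F_tail f (u0 x)" using elim by blast
        \<comment> \<open>Zeros of the datum are excluded by the convention F(0) = \<infinity>,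
          which makes the quotient \<open>0\<close>.\<close>
        have "u0 x \<noteq> 0"
        proof
          assume "u0 x = 0"
          then have "F_tail f (u0 x) = top" by (simp add: F_tail_def)
          then have "ennreal ((norm x)\<^sup>2) / F_tail f (u0 x) = 0" by simp
          then show False using gt by (metis not_less_zero)
        qed
        then have pos: "u0 x > 0" using elim by simp
        have "ennreal (3 * N) < ennreal ((norm x)\<^sup>2 / F (u0 x))"
          using gt F_pos[OF pos] by (simp add: F_tail_eq[OF pos] divide_ennreal)
        then have "3 * N < (norm x)\<^sup>2 / F (u0 x)" using N by (simp add: ennreal_less_iff)
        then show "0 < u0 x \<and> F (u0 x) \<le> (norm x)\<^sup>2 / (3 * N)"
          using pos F_pos[OF pos] N by (simp add: field_simps)
      qed
    qed
    then have "\<not> global_solution f u0 u"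
      using u0 R(1) N by (intro no_global_solution[of u0 "3 * N" R u]) (auto simp: N_def)
    then show False using u by blast
  qed
qed

end
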